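(* Let $n\ge2$ and equip $\mathbf{R}_+^*\times\mathbf{D}^{n-1}$, with coordinates $(P_0,\mu_1,\dots,\mu_{n-1})$, with the Riemannian metric $$ds^2=n\frac{dP_0^2}{P_0^2}+\sum_{k=1}^{n-1}(n-k)\frac{|d\mu_k|^2}{(1-|\mu_k|^2)^2}.$$ Then $(\mathbf{R}_+^*\times\mathbf{D}^{n-1},ds^2)$ is a Cartan-Hadamard manifold whose sectional curvatures $K$ satisfy $-4\le K\le0$.
   Context: $\mathbf{R}_+^*=(0,\infty)$ and $\mathbf{D}=\{z\in\mathbf{C}:|z|<1\}$. A Cartan-Hadamard manifold is a complete, simply connected Riemannian manifold of nonpositive sectional curvature. (This space is the reflection coefficient parametrization of the manifold of $n\times n$ Toeplitz Hermitian positive definite matrices.) *)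

theory Defs
  imports "HOL-Analysis.Analysis"
begin

text \<open>
  Riemannian geometry of a manifold covered by a single global chart, i.e. of an open subset
  \<open>U\<close> of a Euclidean space. Tangent spaces are identified with the ambient space \<open>'a\<close>, a
  metric is a map \<open>g\<close> with \<open>g p v w\<close> the inner product of \<open>v\<close> and \<open>w\<close> at \<open>p\<close>, and
  vector fields are maps \<open>'a \<Rightarrow> 'a\<close>.
\<close>

primrec Ck_on :: "nat \<Rightarrow> ('a::euclidean_space \<Rightarrow> real) \<Rightarrow> 'a set \<Rightarrow> bool" where
  "Ck_on 0 f U \<longleftrightarrow> continuous_on U f"
| "Ck_on (Suc k) f U \<longleftrightarrow>
     f differentiable_on U \<and> (\<forall>v. Ck_on k (\<lambda>x. frechet_derivative f (at x) v) U)"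

definition smooth_on :: "('a::euclidean_space \<Rightarrow> real) \<Rightarrow> 'a set \<Rightarrow> bool" where
  "smooth_on f U \<longleftrightarrow> (\<forall>k. Ck_on k f U)"

definition riemannian_metric_on ::
    "'a::euclidean_space set \<Rightarrow> ('a \<Rightarrow> 'a \<Rightarrow> 'a \<Rightarrow> real) \<Rightarrow> bool" where
  "riemannian_metric_on U g \<longleftrightarrow>
     open U \<and>
     (\<forall>p\<in>U. bilinear (g p) \<and> (\<forall>v w. g p v w = g p w v) \<and> (\<forall>v. v \<noteq> 0 \<longrightarrow> g p v v > 0)) \<and>
     (\<forall>v w. smooth_on (\<lambda>p. g p v w) U)"

text \<open>
  The infimum of the lengths of piecewise \<open>C\<^sup>1\<close> curves in \<open>U\<close> from \<open>p\<close> to \<open>q\<close>.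
  A \<^const>\<open>valid_path\<close> may have unbounded speed near its break points; using
  \<^const>\<open>has_integral\<close> excludes the curves of infinite length, on which
  \<^const>\<open>integral\<close> would return 0. The value off \<open>U\<close> is irrelevant, but
  \<^const>\<open>Metric_space\<close> demands nonnegativity there as well.
\<close>

definition riemannian_dist ::
    "'a::euclidean_space set \<Rightarrow> ('a \<Rightarrow> 'a \<Rightarrow> 'a \<Rightarrow> real) \<Rightarrow> 'a \<Rightarrow> 'a \<Rightarrow> real" where
  "riemannian_dist U g p q =
     (if p \<in> U \<and> q \<in> U then
        Inf {L. \<exists>\<gamma>. valid_path \<gamma> \<and> path_image \<gamma> \<subseteq> U \<and> pathstart \<gamma> = p \<and> pathfinish \<gamma> = q \<and>
               ((\<lambda>t. sqrt (g (\<gamma> t) (vector_derivative \<gamma> (at t)) (vector_derivative \<gamma> (at t))))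
                  has_integral L) {0..1}}
      else 0)"

definition riemannian_complete ::
    "'a::euclidean_space set \<Rightarrow> ('a \<Rightarrow> 'a \<Rightarrow> 'a \<Rightarrow> real) \<Rightarrow> bool" where
  "riemannian_complete U g \<longleftrightarrow>
     Metric_space U (riemannian_dist U g) \<and> Metric_space.mcomplete U (riemannian_dist U g)"

text \<open>
  \<open>christoffel g p v w\<close> is the Levi-Civita covariant derivative at \<open>p\<close> of the constant field
  \<open>w\<close> in direction \<open>v\<close>, given by the Koszul formula (constant fields have zero brackets).
\<close>

definition christoffel ::
    "('a::euclidean_space \<Rightarrow> 'a \<Rightarrow> 'a \<Rightarrow> real) \<Rightarrow> 'a \<Rightarrow> 'a \<Rightarrow> 'a \<Rightarrow> 'a" where
  "christoffel g p v w =
     (THE x. \<forall>z. g p x z =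
        (frechet_derivative (\<lambda>q. g q w z) (at p) v
         + frechet_derivative (\<lambda>q. g q v z) (at p) w
         - frechet_derivative (\<lambda>q. g q v w) (at p) z) / 2)"

definition levi_civita ::
    "('a::euclidean_space \<Rightarrow> 'a \<Rightarrow> 'a \<Rightarrow> real) \<Rightarrow> ('a \<Rightarrow> 'a) \<Rightarrow> ('a \<Rightarrow> 'a) \<Rightarrow> 'a \<Rightarrow> 'a" where
  "levi_civita g X Y p = frechet_derivative Y (at p) (X p) + christoffel g p (X p) (Y p)"

definition lie_bracket :: "('a::euclidean_space \<Rightarrow> 'a) \<Rightarrow> ('a \<Rightarrow> 'a) \<Rightarrow> 'a \<Rightarrow> 'a" where
  "lie_bracket X Y p = frechet_derivative Y (at p) (X p) - frechet_derivative X (at p) (Y p)"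

definition curvature ::
    "('a::euclidean_space \<Rightarrow> 'a \<Rightarrow> 'a \<Rightarrow> real) \<Rightarrow>
       ('a \<Rightarrow> 'a) \<Rightarrow> ('a \<Rightarrow> 'a) \<Rightarrow> ('a \<Rightarrow> 'a) \<Rightarrow> 'a \<Rightarrow> 'a" where
  "curvature g X Y Z p =
     levi_civita g X (levi_civita g Y Z) p - levi_civita g Y (levi_civita g X Z) p
     - levi_civita g (lie_bracket X Y) Z p"

text \<open>
  The curvature is tensorial, so tangent vectors at \<open>p\<close> may be extended to constant fields.
\<close>

definition sectional_curvature ::
    "('a::euclidean_space \<Rightarrow> 'a \<Rightarrow> 'a \<Rightarrow> real) \<Rightarrow> 'a \<Rightarrow> 'a \<Rightarrow> 'a \<Rightarrow> real" where
  "sectional_curvature g p u v =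
     g p (curvature g (\<lambda>_. u) (\<lambda>_. v) (\<lambda>_. v) p) u / (g p u u * g p v v - (g p u v)\<^sup>2)"

definition sectional_curvatures ::
    "'a::euclidean_space set \<Rightarrow> ('a \<Rightarrow> 'a \<Rightarrow> 'a \<Rightarrow> real) \<Rightarrow> real set" where
  "sectional_curvatures U g =
     {sectional_curvature g p u v | p u v. p \<in> U \<and> u \<noteq> v \<and> independent {u, v}}"

definition cartan_hadamard ::
    "'a::euclidean_space set \<Rightarrow> ('a \<Rightarrow> 'a \<Rightarrow> 'a \<Rightarrow> real) \<Rightarrow> bool" where
  "cartan_hadamard U g \<longleftrightarrow>
     riemannian_metric_on U g \<and> riemannian_complete U g \<and> simply_connected U \<and>
     (\<forall>K \<in> sectional_curvatures U g. K \<le> 0)"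

text \<open>
  The reflection coefficient space. The coordinates \<open>\<mu>\<^sub>1, \<dots>, \<mu>\<^bsub>n-1\<^esub>\<close> form a vector
  indexed by a finite type \<open>'m\<close>; a bijection \<open>idx\<close> from \<open>'m\<close> onto \<open>{1..n-1}\<close> gives the
  number of each coordinate.
\<close>

definition refl_space :: "(real \<times> (complex ^ 'm)) set" where
  "refl_space = {0<..} \<times> {\<mu>. \<forall>i. \<mu> $ i \<in> ball 0 1}"

text \<open>
  The symmetric bilinear form polarising \<open>ds\<^sup>2\<close>; \<open>\<bullet>\<close> on \<^typ>\<open>complex\<close> is the real inner
  product, so \<open>\<xi> \<bullet> \<xi> = \<bar>\<xi>\<bar>\<^sup>2\<close>.
\<close>

definition refl_metric ::
    "nat \<Rightarrow> ('m::finite \<Rightarrow> nat) \<Rightarrow>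
       real \<times> (complex ^ 'm) \<Rightarrow> real \<times> (complex ^ 'm) \<Rightarrow> real \<times> (complex ^ 'm) \<Rightarrow> real" where
  "refl_metric n idx = (\<lambda>(P, \<mu>) (a, \<xi>) (b, \<eta>).
     real n * (a * b) / P\<^sup>2 +
     (\<Sum>i\<in>UNIV. (real n - real (idx i)) * (\<xi> $ i \<bullet> \<eta> $ i) / (1 - (cmod (\<mu> $ i))\<^sup>2)\<^sup>2))"

end

theory Submission
  imports Defs
begin

text \<open>
  The metric is a Riemannian product of a line \<open>n dP\<^sup>2 / P\<^sup>2\<close> and of Poincare discs
  \<open>c\<^sub>i |d\<mu>|\<^sup>2 / (1 - |\<mu>|\<^sup>2)\<^sup>2\<close> with \<open>c\<^sub>i = n - i \<ge> 1\<close>; the disc factors have constant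
  curvature \<open>-4 / c\<^sub>i\<close>.

  Curvature. The Christoffel symbols split along the factors, and on a disc they are the complex
  bilinear map \<open>\<Gamma>(v, w) = 2 cnj \<mu> v w / (1 - |\<mu>|\<^sup>2)\<close> (\<open>christoffel_disc\<close>). Hence the quadratic
  \<open>\<Gamma>\<Gamma>\<close>-terms cancel, and \<open>g(R(u,v)v, u)\<close> is \<open>-4\<close> times
  \<open>\<Sum>\<^sub>i c\<^sub>i (Im (cnj u\<^sub>i v\<^sub>i))\<^sup>2 / (1 - |\<mu>\<^sub>i|\<^sup>2)\<^sup>4\<close> (\<open>curvature_numerator\<close>). Since \<open>c\<^sub>i \<ge> 1\<close>, the sum
  is at most the sum of the Gram determinants of the components of \<open>u\<close> and \<open>v\<close> in the factors,
  and Gram determinants are superadditive over orthogonal sums (\<open>gram_sum\<close>). So the sum lies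
  between \<open>0\<close> and the Gram determinant of \<open>u\<close> and \<open>v\<close>, and the quotient between \<open>-4\<close> and \<open>0\<close>.

  Completeness. A function whose differential is bounded by a multiple of the metric norm is
  Lipschitz for the Riemannian distance. The functions \<open>ln P\<close>, the real coordinates of the \<open>\<mu>\<^sub>i\<close>
  and \<open>- ln (1 - |\<mu>\<^sub>i|\<^sup>2)\<close> have this property. Along a Cauchy sequence they all converge; the
  first and the last kind then keep the limit away from the boundary, so the sequence has a limit
  in the space for the Euclidean topology, and also for the Riemannian distance, because short
  segments near the limit have length comparable to their Euclidean length
  (\<open>complete_by_lipschitz_functions\<close>).

  Simple connectedness holds because the space is convex.
\<close>

section \<open>Smoothness of rational functions\<close>

text \<open>
  Rational functions without poles. The class is closed under directional derivatives, so a single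
  differentiation step yields derivatives of all orders.
\<close>

inductive rational_on :: "'a::euclidean_space set \<Rightarrow> ('a \<Rightarrow> real) \<Rightarrow> bool" for U where
  const: "rational_on U (\<lambda>_. c)"
| linear: "bounded_linear f \<Longrightarrow> rational_on U f"
| add: "rational_on U f \<Longrightarrow> rational_on U h \<Longrightarrow> rational_on U (\<lambda>x. f x + h x)"
| mult: "rational_on U f \<Longrightarrow> rational_on U h \<Longrightarrow> rational_on U (\<lambda>x. f x * h x)"
| inverse: "rational_on U f \<Longrightarrow> (\<And>x. x \<in> U \<Longrightarrow> f x \<noteq> 0) \<Longrightarrow> rational_on U (\<lambda>x. inverse (f x))"

lemma rational_on_sum:
  assumes "\<And>i. i \<in> I \<Longrightarrow> rational_on U (f i)"
  shows "rational_on U (\<lambda>x. \<Sum>i\<in>I. f i x)"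
  using assms
  by (induction I rule: infinite_finite_induct) (auto intro: rational_on.intros)

lemma rational_on_derivative:
  assumes "rational_on U f"
  shows "\<exists>f'. (\<forall>x\<in>U. (f has_derivative f' x) (at x)) \<and> (\<forall>v. rational_on U (\<lambda>x. f' x v))"
  using assms
proof induction
  case (const c)
  show ?case
    by (rule exI[of _ "\<lambda>_ _. 0"]) (auto intro: rational_on.const)
next
  case (linear f)
  then show ?case
    by (intro exI[of _ "\<lambda>_. f"]) (auto intro: rational_on.const bounded_linear_imp_has_derivative)
next
  case (add f h)
  then obtain f' h' where
    "\<forall>x\<in>U. (f has_derivative f' x) (at x)" "\<forall>v. rational_on U (\<lambda>x. f' x v)"
    "\<forall>x\<in>U. (h has_derivative h' x) (at x)" "\<forall>v. rational_on U (\<lambda>x. h' x v)"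
    by blast
  then show ?case
    by (intro exI[of _ "\<lambda>x v. f' x v + h' x v"])
       (auto intro: rational_on.add has_derivative_add)
next
  case (mult f h)
  then obtain f' h' where
    "\<forall>x\<in>U. (f has_derivative f' x) (at x)" "\<forall>v. rational_on U (\<lambda>x. f' x v)"
    "\<forall>x\<in>U. (h has_derivative h' x) (at x)" "\<forall>v. rational_on U (\<lambda>x. h' x v)"
    by blast
  with mult.hyps show ?case
    by (intro exI[of _ "\<lambda>x v. f x * h' x v + f' x v * h x"])
       (auto intro!: rational_on.add rational_on.mult has_derivative_mult)
next
  case (inverse f)
  then obtain f' where
    f': "\<forall>x\<in>U. (f has_derivative f' x) (at x)" "\<forall>v. rational_on U (\<lambda>x. f' x v)"
    by blast
  have "rational_on U (\<lambda>x. (-1) * (inverse (f x) * f' x v * inverse (f x)))" for v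
    using inverse.hyps f'(2) by (intro rational_on.mult rational_on.const rational_on.inverse) auto
  with f'(1) inverse.hyps show ?case
    by (intro exI[of _ "\<lambda>x v. - (inverse (f x) * f' x v * inverse (f x))"])
       (auto intro: has_derivative_inverse)
qed

lemma Ck_on_cong:
  assumes "open U" "\<And>x. x \<in> U \<Longrightarrow> f x = h x" "Ck_on k f U"
  shows "Ck_on k h U"
  using assms(2,3)
proof (induction k arbitrary: f h)
  case 0
  then show ?case by (simp cong: continuous_on_cong)
next
  case (Suc k)
  have "Ck_on k (\<lambda>x. frechet_derivative h (at x) v) U" for v
  proof (rule Suc.IH[of "\<lambda>x. frechet_derivative f (at x) v"])
    fix x assume "x \<in> U"
    moreover from this have "f differentiable at x"
      using Suc.prems assms(1) by (simp add: differentiable_on_eq_differentiable_at)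
    ultimately show "frechet_derivative f (at x) v = frechet_derivative h (at x) v"
      using Suc.prems(1) assms(1)
      by (metis frechet_derivative_transform_within_open)
  qed (use Suc.prems in simp)
  moreover have "h differentiable_on U"
    using Suc.prems by (auto simp: differentiable_on_def intro: differentiable_transform_within[of _ _ _ 1])
  ultimately show ?case by simp
qed

lemma smooth_on_rational:
  assumes "open U" "rational_on U f"
  shows "smooth_on f U"
proof -
  have "Ck_on k f U" for k
    using assms(2)
  proof (induction k arbitrary: f)
    case 0
    then show ?case
      using rational_on_derivative[OF 0]
      by (auto intro!: continuous_at_imp_continuous_on dest: has_derivative_continuous)
  next
    case (Suc k)
    obtain f' where
      f': "\<And>x. x \<in> U \<Longrightarrow> (f has_derivative f' x) (at x)" "\<And>v. rational_on U (\<lambda>x. f' x v)"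
      using rational_on_derivative[OF Suc.prems] by blast
    have "Ck_on k (\<lambda>x. frechet_derivative f (at x) v) U" for v
      by (rule Ck_on_cong[OF assms(1) _ Suc.IH[OF f'(2)[of v]]])
         (simp add: frechet_derivative_at[OF f'(1), symmetric])
    moreover have "f differentiable_on U"
      using f'(1) by (meson differentiableI differentiable_at_imp_differentiable_on)
    ultimately show ?case by simp
  qed
  then show ?thesis by (simp add: smooth_on_def)
qed

section \<open>Riemannian distance and completeness on convex domains\<close>

definition connects ::
    "'a::euclidean_space set \<Rightarrow> ('a \<Rightarrow> 'a \<Rightarrow> 'a \<Rightarrow> real) \<Rightarrow> 'a \<Rightarrow> 'a \<Rightarrow> real \<Rightarrow> bool" where
  "connects U g p q L \<longleftrightarrow>
     (\<exists>\<gamma>. valid_path \<gamma> \<and> path_image \<gamma> \<subseteq> U \<and> pathstart \<gamma> = p \<and> pathfinish \<gamma> = q \<and>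
        ((\<lambda>t. sqrt (g (\<gamma> t) (vector_derivative \<gamma> (at t)) (vector_derivative \<gamma> (at t))))
           has_integral L) {0..1})"

lemma riemannian_dist_connects:
  "p \<in> U \<Longrightarrow> q \<in> U \<Longrightarrow> riemannian_dist U g p q = Inf {L. connects U g p q L}"
  by (simp add: riemannian_dist_def connects_def)

lemma metric_nonneg:
  assumes "riemannian_metric_on U g" "p \<in> U"
  shows "g p v v \<ge> 0"
proof (cases "v = 0")
  case True
  have "bilinear (g p)"
    using assms unfolding riemannian_metric_on_def by blast
  then show ?thesis
    using True bilinear_lzero[of "g p"] by simp
next
  case False
  then show ?thesis
    using assms less_imp_le unfolding riemannian_metric_on_def by blast
qed

lemma metric_scale:
  assumes "riemannian_metric_on U g" "p \<in> U"
  shows "sqrt (g p (c *\<^sub>R v) (c *\<^sub>R v)) = \<bar>c\<bar> * sqrt (g p v v)"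
proof -
  have "bilinear (g p)"
    using assms unfolding riemannian_metric_on_def by blast
  then have "g p (c *\<^sub>R v) (c *\<^sub>R v) = c\<^sup>2 * g p v v"
    by (simp add: bilinear_lmul bilinear_rmul power2_eq_square)
  then show ?thesis
    by (simp add: real_sqrt_mult)
qed

lemma connects_nonneg:
  assumes "riemannian_metric_on U g" "connects U g p q L"
  shows "L \<ge> 0"
proof -
  obtain \<gamma> where \<gamma>: "path_image \<gamma> \<subseteq> U"
    "((\<lambda>t. sqrt (g (\<gamma> t) (vector_derivative \<gamma> (at t)) (vector_derivative \<gamma> (at t))))
       has_integral L) {0..1}"
    using assms(2) unfolding connects_def by blast
  show ?thesis
    using \<gamma>(1) metric_nonneg[OF assms(1)]
    by (intro has_integral_nonneg[OF \<gamma>(2)]) (auto simp: path_image_def image_subset_iff)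
qed

lemma connects_sym:
  assumes g: "riemannian_metric_on U g" and "connects U g p q L"
  shows "connects U g q p L"
proof -
  let ?s = "\<lambda>\<gamma> t. sqrt (g (\<gamma> t) (vector_derivative \<gamma> (at t)) (vector_derivative \<gamma> (at t)))"
  obtain \<gamma> where \<gamma>: "valid_path \<gamma>" "path_image \<gamma> \<subseteq> U" "pathstart \<gamma> = p" "pathfinish \<gamma> = q"
    and L: "(?s \<gamma> has_integral L) {0..1}"
    using assms(2) unfolding connects_def by blast
  obtain S where S: "finite S" "\<And>t. t \<in> {0..1} - S \<Longrightarrow> \<gamma> differentiable at t"
    using \<gamma>(1) by (auto simp: valid_path_def piecewise_C1_differentiable_on_def C1_differentiable_on_eq)
  have speed: "?s (reversepath \<gamma>) t = ?s \<gamma> (1 - t)"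
    if t: "t \<in> {0..1} - (\<lambda>x. 1 - x) ` S" for t
  proof -
    have "1 - t \<in> {0..1} - S"
      using t by (auto simp: image_iff) 
    then have "(\<gamma> has_vector_derivative vector_derivative \<gamma> (at (1 - t))) (at (1 - t))"
      using S(2) vector_derivative_works by blast
    moreover have "((\<lambda>x. 1 - x) has_vector_derivative (-1)) (at t)"
      by (auto intro!: derivative_eq_intros)
    ultimately have "(\<gamma> \<circ> (\<lambda>x. 1 - x) has_vector_derivative
        (-1) *\<^sub>R vector_derivative \<gamma> (at (1 - t))) (at t)"
      by (intro vector_diff_chain_at)
    then have "vector_derivative (reversepath \<gamma>) (at t) = (-1) *\<^sub>R vector_derivative \<gamma> (at (1 - t))"
      by (simp add: vector_derivative_at reversepath_def o_def)
    moreover have "\<gamma> (1 - t) \<in> U"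
      using \<gamma>(2) t by (auto simp: path_image_def)
    ultimately show ?thesis
      using metric_scale[OF g, of "\<gamma> (1 - t)" "-1" "vector_derivative \<gamma> (at (1 - t))"]
      by (simp add: reversepath_def)
  qed
  have "((\<lambda>t. ?s \<gamma> (1 - t)) has_integral L) {0..1}"
    using has_integral_affinity01[OF L, where m = "-1" and c = 1] by simp
  then have "(?s (reversepath \<gamma>) has_integral L) {0..1}"
    by (rule has_integral_spike_finite[rotated 2, where S = "(\<lambda>x. 1 - x) ` S"])
       (use S(1) speed in auto)
  then show ?thesis
    using \<gamma> unfolding connects_def by (intro exI[of _ "reversepath \<gamma>"]) auto
qed

text \<open>
  At the junction and at the break points of the two paths the speed of the joined path is
  unknown, but these are finitely many points, which the integral does not see.
\<close>

lemma connects_trans: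
  assumes g: "riemannian_metric_on U g" and "connects U g p q L" "connects U g q r M"
  shows "connects U g p r (L + M)"
proof -
  let ?s = "\<lambda>\<gamma> t. sqrt (g (\<gamma> t) (vector_derivative \<gamma> (at t)) (vector_derivative \<gamma> (at t)))"
  obtain \<gamma>1 where \<gamma>1: "valid_path \<gamma>1" "path_image \<gamma>1 \<subseteq> U" "pathstart \<gamma>1 = p" "pathfinish \<gamma>1 = q"
    and L: "(?s \<gamma>1 has_integral L) {0..1}"
    using assms(2) unfolding connects_def by blast
  obtain \<gamma>2 where \<gamma>2: "valid_path \<gamma>2" "path_image \<gamma>2 \<subseteq> U" "pathstart \<gamma>2 = q" "pathfinish \<gamma>2 = r"
    and M: "(?s \<gamma>2 has_integral M) {0..1}"
    using assms(3) unfolding connects_def by blast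
  obtain S1 where S1: "finite S1" "\<And>t. t \<in> {0..1} - S1 \<Longrightarrow> \<gamma>1 differentiable at t"
    using \<gamma>1(1) by (auto simp: valid_path_def piecewise_C1_differentiable_on_def C1_differentiable_on_eq)
  obtain S2 where S2: "finite S2" "\<And>t. t \<in> {0..1} - S2 \<Longrightarrow> \<gamma>2 differentiable at t"
    using \<gamma>2(1) by (auto simp: valid_path_def piecewise_C1_differentiable_on_def C1_differentiable_on_eq)
  have L': "((\<lambda>t. 2 * ?s \<gamma>1 (2 * t)) has_integral L) {0..1/2}"
    using has_integral_affinity01[OF L, where m = 2 and c = 0, THEN has_integral_mult_right[where c = 2]]
    by (simp add: image_affinity_atLeastAtMost_div_diff)
  have M': "((\<lambda>t. 2 * ?s \<gamma>2 (2 * t - 1)) has_integral M) {1/2..1}"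
    using has_integral_affinity01[OF M, where m = 2 and c = "-1", THEN has_integral_mult_right[where c = 2]]
    by (simp add: image_affinity_atLeastAtMost_div)
  have 1: "?s (\<gamma>1 +++ \<gamma>2) t = 2 * ?s \<gamma>1 (2 * t)"
    if t: "t \<in> {0..1/2} - insert (1/2) ((*) 2 -` S1)" for t
  proof -
    have "vector_derivative (\<gamma>1 +++ \<gamma>2) (at t) = 2 *\<^sub>R vector_derivative \<gamma>1 (at (2 * t))"
    proof (rule vector_derivative_at[OF has_vector_derivative_transform_within])
      show "0 < \<bar>t - 1/2\<bar>"
        using t by auto
      have "((*) 2 has_vector_derivative 2) (at t)"
        by (simp add: has_vector_derivative_def has_derivative_def bounded_linear_mult_left)
      moreover have "(\<gamma>1 has_vector_derivative vector_derivative \<gamma>1 (at (2 * t))) (at (2 * t))"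
        using S1 t by (auto simp: vector_derivative_works[symmetric])
      ultimately
      show "((\<lambda>x. \<gamma>1 (2 * x)) has_vector_derivative 2 *\<^sub>R vector_derivative \<gamma>1 (at (2 * t))) (at t)"
        by (intro vector_diff_chain_at[simplified o_def])
    qed (use t in \<open>simp_all add: joinpaths_def dist_real_def abs_if split: if_split_asm\<close>)
    moreover have "\<gamma>1 (2 * t) \<in> U"
      using \<gamma>1(2) t by (auto simp: path_image_def image_subset_iff)
    ultimately show ?thesis
      using metric_scale[OF g, of "\<gamma>1 (2 * t)" 2 "vector_derivative \<gamma>1 (at (2 * t))"] t
      by (simp add: joinpaths_def)
  qed
  have 2: "?s (\<gamma>1 +++ \<gamma>2) t = 2 * ?s \<gamma>2 (2 * t - 1)"
    if t: "t \<in> {1/2..1} - insert (1/2) ((\<lambda>x. 2 * x - 1) -` S2)" for t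
  proof -
    have "vector_derivative (\<gamma>1 +++ \<gamma>2) (at t) = 2 *\<^sub>R vector_derivative \<gamma>2 (at (2 * t - 1))"
    proof (rule vector_derivative_at[OF has_vector_derivative_transform_within])
      show "0 < \<bar>t - 1/2\<bar>"
        using t by auto
      have "((\<lambda>x. 2 * x - 1) has_vector_derivative 2) (at t)"
        by (simp add: has_vector_derivative_def has_derivative_def bounded_linear_mult_left)
      moreover have "(\<gamma>2 has_vector_derivative vector_derivative \<gamma>2 (at (2 * t - 1))) (at (2 * t - 1))"
        using S2 t by (auto simp: vector_derivative_works[symmetric])
      ultimately
      show "((\<lambda>x. \<gamma>2 (2 * x - 1)) has_vector_derivative 2 *\<^sub>R vector_derivative \<gamma>2 (at (2 * t - 1))) (at t)"
        by (intro vector_diff_chain_at[simplified o_def])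
    qed (use t in \<open>simp_all add: joinpaths_def dist_real_def abs_if split: if_split_asm\<close>)
    moreover have "\<gamma>2 (2 * t - 1) \<in> U"
      using \<gamma>2(2) t by (auto simp: path_image_def image_subset_iff)
    ultimately show ?thesis
      using metric_scale[OF g, of "\<gamma>2 (2 * t - 1)" 2 "vector_derivative \<gamma>2 (at (2 * t - 1))"] t
      by (simp add: joinpaths_def)
  qed
  have "(?s (\<gamma>1 +++ \<gamma>2) has_integral L) {0..1/2}"
  proof (rule has_integral_spike_finite[OF _ _ L'])
    show "finite (insert (1/2) ((*) 2 -` S1))"
      using S1 by (force intro: finite_vimageI[where h = "(*) 2"] inj_onI)
  qed (use 1 in blast)
  moreover have "(?s (\<gamma>1 +++ \<gamma>2) has_integral M) {1/2..1}"
  proof (rule has_integral_spike_finite[OF _ _ M'])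
    show "finite (insert (1/2) ((\<lambda>x. 2 * x - 1) -` S2))"
      using S2 by (force intro: finite_vimageI[where h = "\<lambda>x. 2 * x - 1"] inj_onI)
  qed (use 2 in blast)
  ultimately have "(?s (\<gamma>1 +++ \<gamma>2) has_integral (L + M)) {0..1}"
    by (intro has_integral_combine[where c = "1/2"]) auto
  then show ?thesis
    using \<gamma>1 \<gamma>2 unfolding connects_def
    by (intro exI[of _ "\<gamma>1 +++ \<gamma>2"]) (auto simp: path_image_join valid_path_join)
qed

lemma connects_segment:
  assumes g: "riemannian_metric_on U g" and "closed_segment p q \<subseteq> U" "M \<ge> 0"
    and M: "\<And>x v. x \<in> closed_segment p q \<Longrightarrow> sqrt (g x v v) \<le> M * norm v"
  shows "\<exists>L. connects U g p q L \<and> L \<le> M * norm (q - p)"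
proof -
  let ?h = "\<lambda>t. sqrt (g (linepath p q t) (q - p) (q - p))"
  have "smooth_on (\<lambda>x. g x (q - p) (q - p)) U"
    using g unfolding riemannian_metric_on_def by blast
  then have "Ck_on 0 (\<lambda>x. g x (q - p) (q - p)) U"
    unfolding smooth_on_def by blast
  then have "continuous_on U (\<lambda>x. g x (q - p) (q - p))"
    by simp
  moreover have "linepath p q ` {0..1} \<subseteq> U"
    using assms(2) by (simp add: linepath_image_01)
  ultimately have "continuous_on {0..1} ?h"
    by (intro continuous_on_real_sqrt
        continuous_on_compose2[of U "\<lambda>x. g x (q - p) (q - p)" _ "linepath p q"] continuous_on_linepath)
  then have int: "(?h has_integral integral {0..1} ?h) {0..1}"
    by (intro integrable_integral integrable_continuous_real)
  then have "connects U g p q (integral {0..1} ?h)"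
    using assms(2) unfolding connects_def by (intro exI[of _ "linepath p q"]) auto
  moreover have "integral {0..1} ?h \<le> M * norm (q - p)"
  proof -
    have "?h t \<le> M * norm (q - p)" if "t \<in> {0..1}" for t
      using M that linepath_in_path by blast
    then have "integral {0..1} ?h \<le> integral {0..1::real} (\<lambda>_. M * norm (q - p))"
      using int by (intro integral_le) auto
    then show ?thesis by simp
  qed
  ultimately show ?thesis by blast
qed

text \<open>
  By bilinearity it suffices to bound the finitely many entries of the Gram matrix on a basis,
  each of which is continuous.
\<close>

lemma metric_bounded_on_compact:
  assumes g: "riemannian_metric_on U g" and "compact K" "K \<subseteq> U"
  shows "\<exists>M\<ge>0. \<forall>x\<in>K. \<forall>v. sqrt (g x v v) \<le> M * norm v"
proof -
  have "\<exists>B. \<forall>x\<in>K. \<bar>g x b c\<bar> \<le> B" for b c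
  proof -
    have "smooth_on (\<lambda>x. g x b c) U"
      using g unfolding riemannian_metric_on_def by blast
    then have "Ck_on 0 (\<lambda>x. g x b c) U"
      unfolding smooth_on_def by blast
    then have "continuous_on K (\<lambda>x. g x b c)"
      using assms(3) by (auto intro: continuous_on_subset)
    then have "bounded ((\<lambda>x. g x b c) ` K)"
      using assms(2) by (intro compact_imp_bounded compact_continuous_image)
    then show ?thesis
      by (auto simp: bounded_iff)
  qed
  then obtain B where B: "\<And>b c x. x \<in> K \<Longrightarrow> \<bar>g x b c\<bar> \<le> B b c"
    by metis
  define C where "C = (\<Sum>b\<in>Basis. \<Sum>c\<in>Basis. \<bar>B b c\<bar>)"
  have "C \<ge> 0"
    unfolding C_def by (intro sum_nonneg) auto
  have "g x v v \<le> C * (norm v)\<^sup>2" if "x \<in> K" for x v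
  proof -
    have bil: "bilinear (g x)"
      using g that assms(3) unfolding riemannian_metric_on_def by blast
    have "g x v v = g x (\<Sum>b\<in>Basis. (v \<bullet> b) *\<^sub>R b) (\<Sum>c\<in>Basis. (v \<bullet> c) *\<^sub>R c)"
      by (simp add: euclidean_representation)
    also have "\<dots> = (\<Sum>b\<in>Basis. \<Sum>c\<in>Basis. (v \<bullet> b) * ((v \<bullet> c) * g x b c))"
      using bil by (simp add: bilinear_sum sum.cartesian_product bilinear_lmul bilinear_rmul)
    also have "\<dots> \<le> (\<Sum>b\<in>Basis. \<Sum>c\<in>Basis. \<bar>B b c\<bar> * (norm v)\<^sup>2)"
    proof (intro sum_mono)
      fix b c :: 'a assume bc: "b \<in> Basis" "c \<in> Basis"
      have "(v \<bullet> b) * ((v \<bullet> c) * g x b c) \<le> \<bar>v \<bullet> b\<bar> * \<bar>v \<bullet> c\<bar> * \<bar>g x b c\<bar>"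
        by (metis abs_ge_self abs_mult mult.assoc)
      also have "\<dots> \<le> norm v * norm v * \<bar>B b c\<bar>"
        using bc B[OF that, of b c] by (intro mult_mono) (auto simp: Basis_le_norm)
      finally show "(v \<bullet> b) * ((v \<bullet> c) * g x b c) \<le> \<bar>B b c\<bar> * (norm v)\<^sup>2"
        by (simp add: power2_eq_square mult_ac)
    qed
    also have "\<dots> = C * (norm v)\<^sup>2"
      by (simp add: C_def sum_distrib_right)
    finally show ?thesis .
  qed
  then have "sqrt (g x v v) \<le> sqrt C * norm v" if "x \<in> K" for x v
    using real_sqrt_le_mono[of "g x v v" "C * (norm v)\<^sup>2"] that by (simp add: real_sqrt_mult)
  then show ?thesis
    using \<open>C \<ge> 0\<close> by (intro exI[of _ "sqrt C"]) simp
qed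

text \<open>Integrate the derivative of \<open>f\<close> along a path and compare it with the speed.\<close>

lemma connects_lipschitz:
  fixes f :: "'a::euclidean_space \<Rightarrow> real"
  assumes D: "\<And>x. x \<in> U \<Longrightarrow> (f has_derivative f' x) (at x)"
    and bound: "\<And>x v. x \<in> U \<Longrightarrow> \<bar>f' x v\<bar> \<le> C * sqrt (g x v v)"
    and "connects U g p q L"
  shows "\<bar>f q - f p\<bar> \<le> C * L"
proof -
  let ?s = "\<lambda>\<gamma> t. sqrt (g (\<gamma> t) (vector_derivative \<gamma> (at t)) (vector_derivative \<gamma> (at t)))"
  obtain \<gamma> where \<gamma>: "valid_path \<gamma>" "path_image \<gamma> \<subseteq> U" "pathstart \<gamma> = p" "pathfinish \<gamma> = q"
    and L: "(?s \<gamma> has_integral L) {0..1}"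
    using assms(3) unfolding connects_def by blast
  obtain S where S: "finite S" "\<And>t. t \<in> {0..1} - S \<Longrightarrow> \<gamma> differentiable at t"
    using \<gamma>(1) by (auto simp: valid_path_def piecewise_C1_differentiable_on_def C1_differentiable_on_eq)
  have U: "\<gamma> t \<in> U" if "t \<in> {0..1}" for t
    using \<gamma>(2) that by (auto simp: path_image_def image_subset_iff)
  let ?d = "\<lambda>t. f' (\<gamma> t) (vector_derivative \<gamma> (at t))"
  have int: "(?d has_integral ((f \<circ> \<gamma>) 1 - (f \<circ> \<gamma>) 0)) {0..1}"
  proof (rule fundamental_theorem_of_calculus_strong[OF S(1)])
    fix t assume t: "t \<in> {0..1} - S"
    then have "(\<gamma> has_derivative (\<lambda>h. h *\<^sub>R vector_derivative \<gamma> (at t))) (at t)"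
      using S(2) vector_derivative_works has_vector_derivative_def by blast
    moreover have D': "(f has_derivative f' (\<gamma> t)) (at (\<gamma> t))"
      using t U D by blast
    ultimately have "(f \<circ> \<gamma> has_derivative f' (\<gamma> t) \<circ> (\<lambda>h. h *\<^sub>R vector_derivative \<gamma> (at t))) (at t)"
      by (rule diff_chain_at)
    moreover have "f' (\<gamma> t) \<circ> (\<lambda>h. h *\<^sub>R vector_derivative \<gamma> (at t)) = (\<lambda>h. h *\<^sub>R ?d t)"
      using has_derivative_linear[OF D'] by (auto simp: linear_cmul)
    ultimately show "(f \<circ> \<gamma> has_vector_derivative ?d t) (at t)"
      by (simp add: has_vector_derivative_def)
  next
    have "continuous_on U f"
      using D by (meson continuous_at_imp_continuous_on has_derivative_continuous)
    then show "continuous_on {0..1} (f \<circ> \<gamma>)"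
      using \<gamma>(1,2) valid_path_imp_path[of \<gamma>] unfolding path_def path_image_def
      by (intro continuous_on_compose) (auto intro: continuous_on_subset)
  qed simp
  have "norm (integral {0..1} ?d) \<le> integral {0..1} (\<lambda>t. C * ?s \<gamma> t)"
    using bound U L int
    by (intro integral_norm_bound_integral) (auto intro!: integrable_on_mult_right)
  also have "\<dots> = C * L"
    using L by (simp add: integral_unique)
  finally show ?thesis
    using int \<gamma>(3,4) by (simp add: integral_unique pathstart_def pathfinish_def)
qed

lemma connects_convex:
  assumes g: "riemannian_metric_on U g" and "convex U" "p \<in> U" "q \<in> U"
  shows "\<exists>L. connects U g p q L"
proof -
  have seg: "closed_segment p q \<subseteq> U"
    using assms by (intro closed_segment_subset)
  obtain M where M: "M \<ge> 0" "\<And>x v. x \<in> closed_segment p q \<Longrightarrow> sqrt (g x v v) \<le> M * norm v"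
    using metric_bounded_on_compact[OF g compact_segment seg] by blast
  show ?thesis
    using connects_segment[OF g seg M] by blast
qed

lemma riemannian_dist_le:
  assumes "riemannian_metric_on U g" "p \<in> U" "q \<in> U" "connects U g p q L"
  shows "riemannian_dist U g p q \<le> L"
  unfolding riemannian_dist_connects[OF assms(2,3)]
proof (rule cInf_lower)
  show "bdd_below {L. connects U g p q L}"
    using connects_nonneg[OF assms(1)] by (intro bdd_belowI[of _ 0]) blast
qed (simp add: assms(4))

lemma riemannian_dist_ge:
  assumes "riemannian_metric_on U g" "convex U" "p \<in> U" "q \<in> U"
    and "\<And>L. connects U g p q L \<Longrightarrow> B \<le> L"
  shows "B \<le> riemannian_dist U g p q"
  unfolding riemannian_dist_connects[OF assms(3,4)]
proof (rule cInf_greatest)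
  show "{L. connects U g p q L} \<noteq> {}"
    using connects_convex[OF assms(1-4)] by simp
  show "B \<le> L" if "L \<in> {L. connects U g p q L}" for L
    using that assms(5)[of L] by simp
qed

lemma riemannian_dist_approx:
  assumes "riemannian_metric_on U g" "convex U" "p \<in> U" "q \<in> U" "e > 0"
  obtains L where "connects U g p q L" "L < riemannian_dist U g p q + e"
proof -
  have "{L. connects U g p q L} \<noteq> {}"
    using connects_convex[OF assms(1-4)] by auto
  moreover have "Inf {L. connects U g p q L} < riemannian_dist U g p q + e"
    using assms(5) by (simp add: riemannian_dist_connects[OF assms(3,4)])
  ultimately obtain L where "L \<in> {L. connects U g p q L}" "L < riemannian_dist U g p q + e"
    using cInf_lessD by metis
  then show thesis
    using that[of L] by simp
qed

text \<open>
  A completeness criterion that avoids geodesics and the Hopf-Rinow theorem. The hypothesis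
  \<open>proper\<close> says that the functions in \<open>F\<close> detect convergence within \<open>U\<close>: together they embed \<open>U\<close>
  as a closed set. It also forces \<open>F\<close> to separate points, which makes the distance definite.
  Convexity of \<open>U\<close> provides paths of finite length between any two points.
\<close>

lemma complete_by_lipschitz_functions:
  fixes F :: "('a::euclidean_space \<Rightarrow> real) set"
  assumes g: "riemannian_metric_on U g" and U: "convex U"
    and F: "\<And>f. f \<in> F \<Longrightarrow> \<exists>f' C. \<forall>x\<in>U. (f has_derivative f' x) (at x) \<and>
              (\<forall>v. \<bar>f' x v\<bar> \<le> C * sqrt (g x v v))"
    and proper: "\<And>x. (\<forall>n. x n \<in> U) \<Longrightarrow> (\<forall>f\<in>F. Cauchy (\<lambda>n. f (x n))) \<Longrightarrow> \<exists>l\<in>U. x \<longlonglongrightarrow> l"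
  shows "riemannian_complete U g"
proof -
  let ?d = "riemannian_dist U g"
  have "\<exists>C>0. \<forall>p\<in>U. \<forall>q\<in>U. \<bar>f q - f p\<bar> \<le> C * ?d p q" if f: "f \<in> F" for f
  proof -
    obtain f' C0 where f': "\<And>x. x \<in> U \<Longrightarrow> (f has_derivative f' x) (at x)"
      and C0: "\<And>x v. x \<in> U \<Longrightarrow> \<bar>f' x v\<bar> \<le> C0 * sqrt (g x v v)"
      using F[OF f] by blast
    \<comment> \<open>A positive constant, since it will be divided by.\<close>
    define C where "C = max C0 1"
    have C: "\<bar>f' x v\<bar> \<le> C * sqrt (g x v v)" if "x \<in> U" for x v
      using C0[OF that, of v] metric_nonneg[OF g that, of v]
        mult_right_mono[of C0 C "sqrt (g x v v)"] by (auto simp: C_def)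
    have "C > 0" by (auto simp: C_def)
    moreover have "\<bar>f q - f p\<bar> \<le> C * ?d p q" if "p \<in> U" "q \<in> U" for p q
    proof -
      have "\<bar>f q - f p\<bar> / C \<le> ?d p q"
      proof (rule riemannian_dist_ge[OF g U that])
        fix L assume "connects U g p q L"
        then have "\<bar>f q - f p\<bar> \<le> C * L"
          using connects_lipschitz[where f = f and f' = f' and U = U and g = g and C = C] f' C by blast
        then show "\<bar>f q - f p\<bar> / C \<le> L"
          using \<open>C > 0\<close> by (simp add: field_simps)
      qed
      then show ?thesis
        using \<open>C > 0\<close> by (simp add: field_simps)
    qed
    ultimately show ?thesis by blast
  qed
  then obtain C where C: "\<And>f. f \<in> F \<Longrightarrow> C f > 0"
    and lip: "\<And>f p q. f \<in> F \<Longrightarrow> p \<in> U \<Longrightarrow> q \<in> U \<Longrightarrow> \<bar>f q - f p\<bar> \<le> C f * ?d p q"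
    by metis
  have sym: "connects U g p q = connects U g q p" for p q
    using connects_sym[OF g] by blast
  interpret Metric_space U ?d
  proof
    show "0 \<le> ?d p q" for p q
    proof (cases "p \<in> U \<and> q \<in> U")
      case True
      then show ?thesis
        using riemannian_dist_ge[OF g U, of p q 0] connects_nonneg[OF g] by blast
    qed (auto simp: riemannian_dist_def)
    show "?d p q = ?d q p" for p q
      using riemannian_dist_connects[of p U q g] riemannian_dist_connects[of q U p g] sym[of p q]
      by (cases "p \<in> U \<and> q \<in> U") (auto simp: riemannian_dist_def)
    show "?d p q = 0 \<longleftrightarrow> p = q" if pq: "p \<in> U" "q \<in> U" for p q
    proof
      assume 0: "?d p q = 0"
      \<comment> \<open>All functions in \<open>F\<close> agree at \<open>p\<close> and \<open>q\<close>, so the sequence alternating between them must converge.\<close>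
      define x where "x = (\<lambda>n::nat. if even n then p else q)"
      have "\<forall>f\<in>F. Cauchy (\<lambda>n. f (x n))"
      proof
        fix f assume "f \<in> F"
        then have "(\<lambda>n. f (x n)) = (\<lambda>_. f p)"
          using lip[of f p q] pq 0 by (auto simp: x_def)
        then show "Cauchy (\<lambda>n. f (x n))"
          using LIMSEQ_imp_Cauchy[OF tendsto_const] by simp
      qed
      moreover have "\<forall>n. x n \<in> U"
        using pq by (simp add: x_def)
      ultimately obtain l where l: "x \<longlonglongrightarrow> l"
        using proper by blast
      have "(x \<circ> (\<lambda>n. 2 * n)) \<longlonglongrightarrow> l" "(x \<circ> (\<lambda>n. 2 * n + 1)) \<longlonglongrightarrow> l"
        by (auto intro!: LIMSEQ_subseq_LIMSEQ[OF l] strict_monoI)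
      then have "p = l" "q = l"
        by (auto simp: x_def o_def LIMSEQ_const_iff)
      then show "p = q" by simp
    next
      assume "p = q"
      have seg: "closed_segment p p \<subseteq> U" using pq by auto
      obtain M where M: "M \<ge> 0" "\<And>x v. x \<in> closed_segment p p \<Longrightarrow> sqrt (g x v v) \<le> M * norm v"
        using metric_bounded_on_compact[OF g compact_segment seg] by blast
      obtain L where "connects U g p p L" "L \<le> 0"
        using connects_segment[OF g seg M] by auto
      then have "?d p p \<le> 0"
        using riemannian_dist_le[OF g pq(1) pq(1)] by fastforce
      moreover have "0 \<le> ?d p p"
        using riemannian_dist_ge[OF g U, of p p 0] connects_nonneg[OF g] pq by blast
      ultimately show "?d p q = 0"
        using \<open>p = q\<close> by simp
    qed
    show "?d p r \<le> ?d p q + ?d q r" if pqr: "p \<in> U" "q \<in> U" "r \<in> U" for p q r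
    proof (rule field_le_epsilon)
      fix e :: real assume "e > 0"
      then have e: "e / 2 > 0" by simp
      obtain L where L: "connects U g p q L" "L < ?d p q + e / 2"
        using riemannian_dist_approx[OF g U pqr(1,2) e] by blast
      obtain M where M: "connects U g q r M" "M < ?d q r + e / 2"
        using riemannian_dist_approx[OF g U pqr(2,3) e] by blast
      show "?d p r \<le> ?d p q + ?d q r + e"
        using riemannian_dist_le[OF g pqr(1,3) connects_trans[OF g L(1) M(1)]] L(2) M(2) by linarith
    qed
  qed
  have "mcomplete"
    unfolding mcomplete_def
  proof (intro allI impI)
    fix x assume x: "MCauchy x"
    then have xU: "\<And>n. x n \<in> U"
      by (auto simp: MCauchy_def)
    have "Cauchy (\<lambda>n. f (x n))" if "f \<in> F" for f
    proof (rule metric_CauchyI)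
      fix e :: real assume "e > 0"
      then have "e / C f > 0" using C[OF that] by simp
      then obtain N where N: "\<And>m n. N \<le> m \<Longrightarrow> N \<le> n \<Longrightarrow> ?d (x m) (x n) < e / C f"
        using x unfolding MCauchy_def by meson
      show "\<exists>N. \<forall>m\<ge>N. \<forall>n\<ge>N. dist (f (x m)) (f (x n)) < e"
      proof (intro exI[of _ N] allI impI)
        fix m n assume "N \<le> m" "N \<le> n"
        then show "dist (f (x m)) (f (x n)) < e"
          using N[of n m] lip[OF that xU xU, of m n] C[OF that]
          by (simp add: dist_real_def pos_less_divide_eq mult.commute)
      qed
    qed
    then obtain l where l: "l \<in> U" "x \<longlonglongrightarrow> l"
      using proper[of x] xU by blast
    have "open U"
      using g unfolding riemannian_metric_on_def by blast
    then obtain r where r: "r > 0" "cball l r \<subseteq> U"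
      using l(1) open_contains_cball by blast
    obtain M where M: "M \<ge> 0" "\<And>y v. y \<in> cball l r \<Longrightarrow> sqrt (g y v v) \<le> M * norm v"
      using metric_bounded_on_compact[OF g compact_cball r(2)] by blast
    have "eventually (\<lambda>n. x n \<in> cball l r) sequentially"
      using tendstoD[OF l(2) r(1)] by eventually_elim (simp add: dist_commute)
    then have ev: "eventually (\<lambda>n. ?d (x n) l \<le> M * norm (l - x n)) sequentially"
    proof (rule eventually_mono)
      fix n assume "x n \<in> cball l r"
      then have seg: "closed_segment (x n) l \<subseteq> cball l r"
        using r(1) by (intro closed_segment_subset) auto
      have "sqrt (g y v v) \<le> M * norm v" if "y \<in> closed_segment (x n) l" for y v
        using that seg M(2) by blast
      then obtain L where "connects U g (x n) l L" "L \<le> M * norm (l - x n)"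
        using connects_segment[OF g subset_trans[OF seg r(2)] M(1)] by blast
      then show "?d (x n) l \<le> M * norm (l - x n)"
        using riemannian_dist_le[OF g xU l(1)] by fastforce
    qed
    have "(\<lambda>n. M * norm (l - x n)) \<longlonglongrightarrow> M * norm (l - l)"
      by (intro tendsto_intros l(2))
    then have "(\<lambda>n. M * norm (l - x n)) \<longlonglongrightarrow> 0"
      by simp
    then have "(\<lambda>n. ?d (x n) l) \<longlonglongrightarrow> 0"
      by (rule Lim_null_comparison[rotated]) (use ev in \<open>auto elim: eventually_mono\<close>)
    then show "\<exists>l. limitin mtopology x l sequentially"
      using l(1) xU by (auto simp: limitin_metric_dist_null)
  qed
  then show ?thesis
    unfolding riemannian_complete_def using Metric_space_axioms by blast
qed

section \<open>The metric on the reflection coefficient space\<close>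

text \<open>
  The weights are arbitrary: positive ones give a Riemannian metric, and those bounded below by
  \<open>1\<close> give uniform estimates for curvature and lengths.
\<close>

definition disc_metric ::
    "real \<Rightarrow> ('m::finite \<Rightarrow> real) \<Rightarrow>
       real \<times> (complex ^ 'm) \<Rightarrow> real \<times> (complex ^ 'm) \<Rightarrow> real \<times> (complex ^ 'm) \<Rightarrow> real" where
  "disc_metric a c p v w = a * (fst v * fst w) / (fst p)\<^sup>2 +
     (\<Sum>i\<in>UNIV. c i * (snd v $ i \<bullet> snd w $ i) / (1 - (cmod (snd p $ i))\<^sup>2)\<^sup>2)"

lemma refl_metric_eq: "refl_metric n idx = disc_metric (real n) (\<lambda>i. real n - real (idx i))"
  by (auto simp: fun_eq_iff refl_metric_def disc_metric_def)

lemma refl_space_iff: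
  "p \<in> refl_space \<longleftrightarrow> fst p > 0 \<and> (\<forall>i. cmod (snd p $ i) < 1)"
  by (cases p) (simp add: refl_space_def)

lemma open_refl_space: "open (refl_space :: (real \<times> (complex ^ 'm::finite)) set)"
proof -
  have "{\<mu> :: complex ^ 'm. \<forall>i. \<mu> $ i \<in> ball 0 1} = (\<Inter>i. (\<lambda>\<mu>. \<mu> $ i) -` ball 0 1)"
    by auto
  then show ?thesis
    unfolding refl_space_def
    by (simp only:) (intro open_Times open_greaterThan open_INT finite_class.finite_UNIV ballI open_vimage open_ball
        continuous_on_component continuous_on_id)
qed

lemma convex_refl_space: "convex (refl_space :: (real \<times> (complex ^ 'm::finite)) set)"
proof -
  have "{\<mu> :: complex ^ 'm. \<forall>i. \<mu> $ i \<in> ball 0 1} = (\<Inter>i. (\<lambda>\<mu>. \<mu> $ i) -` ball 0 1)"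
    by auto
  then show ?thesis
    unfolding refl_space_def
    by (simp only:) (intro convex_Times convex_real_interval convex_INT convex_linear_vimage convex_ball
        bounded_linear.linear[OF bounded_linear_vec_nth])
qed

lemma gap_pos: "p \<in> refl_space \<Longrightarrow> 1 - (cmod (snd p $ i))\<^sup>2 > 0"
  using power_strict_mono[of "cmod (snd p $ i)" 1 2] by (auto simp: refl_space_iff)

lemma bilinear_disc_metric: "bilinear (disc_metric a c p)"
  unfolding bilinear_def linear_iff disc_metric_def
  by (auto simp: inner_add_left inner_add_right algebra_simps add_divide_distrib sum.distrib
      sum_distrib_left)

lemma disc_metric_sym: "disc_metric a c p v w = disc_metric a c p w v"
  by (simp add: disc_metric_def inner_commute mult.commute)

lemma disc_metric_ge_fst:
  assumes "\<forall>i. c i \<ge> 0"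
  shows "a * (fst v / fst p)\<^sup>2 \<le> disc_metric a c p v v"
proof -
  have "0 \<le> (\<Sum>i\<in>UNIV. c i * (snd v $ i \<bullet> snd v $ i) / (1 - (cmod (snd p $ i))\<^sup>2)\<^sup>2)"
    using assms by (intro sum_nonneg) simp
  then show ?thesis
    by (simp add: disc_metric_def power2_eq_square)
qed

lemma disc_metric_ge_snd:
  assumes "a \<ge> 0" "\<forall>i. c i \<ge> 0"
  shows "c i * (cmod (snd v $ i) / (1 - (cmod (snd p $ i))\<^sup>2))\<^sup>2 \<le> disc_metric a c p v v"
proof -
  have "c i * (cmod (snd v $ i) / (1 - (cmod (snd p $ i))\<^sup>2))\<^sup>2
      \<le> (\<Sum>i\<in>UNIV. c i * (snd v $ i \<bullet> snd v $ i) / (1 - (cmod (snd p $ i))\<^sup>2)\<^sup>2)"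
    using assms(2) member_le_sum[of i UNIV
        "\<lambda>i. c i * (snd v $ i \<bullet> snd v $ i) / (1 - (cmod (snd p $ i))\<^sup>2)\<^sup>2"]
    by (simp add: dot_square_norm power_divide)
  moreover have "a * (fst v * fst v) / (fst p)\<^sup>2 \<ge> 0"
    using assms(1) by simp
  ultimately show ?thesis
    by (simp add: disc_metric_def)
qed

lemma disc_metric_pos:
  assumes "a > 0" "\<forall>i. c i > 0" "p \<in> refl_space" "v \<noteq> 0"
  shows "disc_metric a c p v v > 0"
proof (cases "fst v = 0")
  case False
  then have "0 < a * (fst v / fst p)\<^sup>2"
    using assms by (auto simp: refl_space_iff)
  also have "\<dots> \<le> disc_metric a c p v v"
    using assms(2) by (intro disc_metric_ge_fst) (simp add: less_imp_le)
  finally show ?thesis .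
next
  case True
  then have "snd v \<noteq> 0"
    using assms(4) by (auto simp: prod_eq_iff)
  then obtain i where "snd v $ i \<noteq> 0"
    by (auto simp: vec_eq_iff)
  then have "0 < c i * (cmod (snd v $ i) / (1 - (cmod (snd p $ i))\<^sup>2))\<^sup>2"
    using assms(2) gap_pos[OF assms(3), of i] by auto
  also have "\<dots> \<le> disc_metric a c p v v"
    using assms(1,2) by (intro disc_metric_ge_snd) (simp_all add: less_imp_le)
  finally show ?thesis .
qed

lemma bounded_linear_coord: "bounded_linear (\<lambda>p :: real \<times> (complex ^ 'm::finite). snd p $ i)"
  by (rule bounded_linear_compose[OF bounded_linear_vec_nth bounded_linear_snd])

lemma smooth_disc_metric:
  "smooth_on (\<lambda>p. disc_metric a c p v w) (refl_space :: (real \<times> (complex ^ 'm::finite)) set)"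
proof (rule smooth_on_rational[OF open_refl_space])
  let ?U = "refl_space :: (real \<times> (complex ^ 'm)) set"
  define r where "r i p = 1 + (-1) * (Re (snd p $ i) * Re (snd p $ i) + Im (snd p $ i) * Im (snd p $ i))"
    for i and p :: "real \<times> (complex ^ 'm)"
  have r: "r i p = 1 - (cmod (snd p $ i))\<^sup>2" for i p
    by (simp only: r_def cmod_power2) (simp add: power2_eq_square)
  have lin: "bounded_linear (\<lambda>p :: real \<times> (complex ^ 'm). Re (snd p $ i))"
    "bounded_linear (\<lambda>p :: real \<times> (complex ^ 'm). Im (snd p $ i))" for i
    by (rule bounded_linear_compose[OF bounded_linear_Re bounded_linear_coord]
        bounded_linear_compose[OF bounded_linear_Im bounded_linear_coord])+
  have "rational_on ?U (r i)" for i
    unfolding r_def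
    by (intro rational_on.const rational_on.add rational_on.mult rational_on.linear[OF lin(1)]
        rational_on.linear[OF lin(2)])
  moreover have "r i p \<noteq> 0" if "p \<in> ?U" for i p
    using gap_pos[OF that, of i] by (simp add: r)
  ultimately have "rational_on ?U (\<lambda>p. a * (fst v * fst w) * inverse (fst p * fst p) +
      (\<Sum>i\<in>UNIV. c i * (snd v $ i \<bullet> snd w $ i) * inverse (r i p * r i p)))"
    by (intro rational_on.const rational_on.add rational_on.mult rational_on.inverse rational_on_sum
        rational_on.linear[OF bounded_linear_fst]) (auto simp: refl_space_iff)
  then show "rational_on ?U (\<lambda>p. disc_metric a c p v w)"
    by (simp add: disc_metric_def[abs_def] r divide_inverse power2_eq_square)
qed

lemma riemannian_disc_metric:
  assumes "a > 0" "\<forall>i. c i > 0"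
  shows "riemannian_metric_on refl_space (disc_metric a c)"
  unfolding riemannian_metric_on_def
  using open_refl_space bilinear_disc_metric disc_metric_sym disc_metric_pos[OF assms] smooth_disc_metric
  by blast

section \<open>Connection and curvature\<close>

lemma has_derivative_vec_lambda:
  fixes f :: "'i::finite \<Rightarrow> 'a::real_normed_vector \<Rightarrow> 'b::euclidean_space"
  assumes "\<And>i. (f i has_derivative f' i) F"
  shows "((\<lambda>x. \<chi> i. f i x) has_derivative (\<lambda>h. \<chi> i. f' i h)) F"
proof -
  have vec: "(\<chi> i. y i) = (\<Sum>i\<in>UNIV. axis i (y i))" for y :: "'i \<Rightarrow> 'b"
    by (simp add: vec_eq_iff axis_def if_distrib cong: if_cong)
  have ax: "bounded_linear (axis i :: 'b \<Rightarrow> 'b ^ 'i)" for i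
    by (simp add: linear_conv_bounded_linear[symmetric] linear_iff vec_eq_iff axis_def)
  then show ?thesis
    unfolding vec using assms by (intro has_derivative_sum bounded_linear.has_derivative[OF ax])
qed

lemma gap_has_derivative:
  "((\<lambda>p :: real \<times> (complex ^ 'm::finite). 1 - (cmod (snd p $ i))\<^sup>2) has_derivative
     (\<lambda>v. - 2 * (snd p $ i \<bullet> snd v $ i))) (at p)"
proof -
  have "((\<lambda>p :: real \<times> (complex ^ 'm). snd p $ i) has_derivative (\<lambda>v. snd v $ i)) (at p)"
    by (rule bounded_linear_imp_has_derivative[OF bounded_linear_coord])
  then have "((\<lambda>p. 1 - snd p $ i \<bullet> snd p $ i) has_derivative
      (\<lambda>v. 0 - (snd p $ i \<bullet> snd v $ i + snd v $ i \<bullet> snd p $ i))) (at p)"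
    by (intro has_derivative_diff has_derivative_const has_derivative_inner)
  then show ?thesis
    by (simp add: dot_square_norm inner_commute)
qed

text \<open>
  On a disc, \<open>disc_metric\<close> is conformal to the flat metric with factor \<open>exp (2 \<phi>)\<close>,
  \<open>\<phi> = - ln (1 - |z|\<^sup>2) + const\<close>. In complex dimension one the connection of such a metric is
  \<open>\<Gamma>(v, w) = 2 (\<partial>\<phi>/\<partial>z) v w\<close>, which gives the formula below; scaling by \<open>c\<^sub>i\<close> does not change it.
  On the line \<open>\<phi> = - ln P\<close> and \<open>\<Gamma>(v, w) = \<phi>' v w\<close>.
\<close>

definition disc_Gamma ::
    "real \<times> (complex ^ 'm::finite) \<Rightarrow> real \<times> (complex ^ 'm) \<Rightarrow> real \<times> (complex ^ 'm) \<Rightarrow> real \<times> (complex ^ 'm)" where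
  "disc_Gamma p v w = (- (fst v * fst w) / fst p,
     \<chi> i. (2 / (1 - (cmod (snd p $ i))\<^sup>2)) *\<^sub>R (cnj (snd p $ i) * (snd v $ i * snd w $ i)))"

definition disc_Gamma_deriv ::
    "real \<times> (complex ^ 'm::finite) \<Rightarrow> real \<times> (complex ^ 'm) \<Rightarrow> real \<times> (complex ^ 'm) \<Rightarrow> real \<times> (complex ^ 'm)
      \<Rightarrow> real \<times> (complex ^ 'm)" where
  "disc_Gamma_deriv p v w u = (fst v * fst w * fst u / (fst p)\<^sup>2,
     \<chi> i. (2 / (1 - (cmod (snd p $ i))\<^sup>2)) *\<^sub>R (cnj (snd u $ i) * (snd v $ i * snd w $ i)) +
          (4 * (snd p $ i \<bullet> snd u $ i) / (1 - (cmod (snd p $ i))\<^sup>2)\<^sup>2) *\<^sub>R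
            (cnj (snd p $ i) * (snd v $ i * snd w $ i)))"

lemma disc_Gamma_has_derivative:
  assumes "p \<in> refl_space"
  shows "((\<lambda>p. disc_Gamma p v w) has_derivative disc_Gamma_deriv p v w) (at p)"
  unfolding disc_Gamma_def disc_Gamma_deriv_def
proof (intro has_derivative_Pair has_derivative_vec_lambda)
  have "fst p \<noteq> 0" using assms by (simp add: refl_space_iff)
  then show "((\<lambda>p. - (fst v * fst w) / fst p) has_derivative (\<lambda>u. fst v * fst w * fst u / (fst p)\<^sup>2)) (at p)"
    by (auto intro!: derivative_eq_intros simp: fun_eq_iff power2_eq_square field_simps)
next
  fix i
  let ?r = "\<lambda>p :: real \<times> (complex ^ 'a). 1 - (cmod (snd p $ i))\<^sup>2"
  have r: "?r p \<noteq> 0" using gap_pos[OF assms, of i] by simp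
  have 1: "((\<lambda>p. 2 / ?r p) has_derivative (\<lambda>u. 4 * (snd p $ i \<bullet> snd u $ i) / (?r p)\<^sup>2)) (at p)"
  proof -
    have "((\<lambda>t. 2 / t) has_real_derivative - 2 / (?r p)\<^sup>2) (at (?r p))"
      using r by (auto intro!: derivative_eq_intros simp: power2_eq_square)
    from DERIV_compose_FDERIV[OF this gap_has_derivative] show ?thesis
      by (rule has_derivative_eq_rhs) (simp add: fun_eq_iff)
  qed
  have "bounded_linear (\<lambda>p :: real \<times> (complex ^ 'a). cnj (snd p $ i) * (snd v $ i * snd w $ i))"
    by (rule bounded_linear_mult_const[OF bounded_linear_compose[OF bounded_linear_cnj bounded_linear_coord]])
  then have 2: "((\<lambda>p. cnj (snd p $ i) * (snd v $ i * snd w $ i)) has_derivative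
      (\<lambda>u. cnj (snd u $ i) * (snd v $ i * snd w $ i))) (at p)"
    by (rule bounded_linear_imp_has_derivative)
  show "((\<lambda>p. (2 / ?r p) *\<^sub>R (cnj (snd p $ i) * (snd v $ i * snd w $ i))) has_derivative
      (\<lambda>u. (2 / ?r p) *\<^sub>R (cnj (snd u $ i) * (snd v $ i * snd w $ i)) +
          (4 * (snd p $ i \<bullet> snd u $ i) / (?r p)\<^sup>2) *\<^sub>R (cnj (snd p $ i) * (snd v $ i * snd w $ i)))) (at p)"
    by (rule has_derivative_scaleR[OF 1 2])
qed

lemma disc_metric_has_derivative:
  assumes "p \<in> refl_space"
  shows "((\<lambda>p. disc_metric a c p v w) has_derivative
    (\<lambda>u. - 2 * a * (fst v * fst w) * fst u / (fst p) ^ 3 +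
       (\<Sum>i\<in>UNIV. 4 * (c i * (snd v $ i \<bullet> snd w $ i)) * (snd p $ i \<bullet> snd u $ i) /
          (1 - (cmod (snd p $ i))\<^sup>2) ^ 3))) (at p)"
  unfolding disc_metric_def
proof (intro has_derivative_add has_derivative_sum)
  have "fst p \<noteq> 0" using assms by (simp add: refl_space_iff)
  then show "((\<lambda>p. a * (fst v * fst w) / (fst p)\<^sup>2) has_derivative
      (\<lambda>u. - 2 * a * (fst v * fst w) * fst u / fst p ^ 3)) (at p)"
    by (auto intro!: derivative_eq_intros simp: fun_eq_iff power2_eq_square power3_eq_cube divide_simps)
next
  fix i
  let ?r = "\<lambda>p :: real \<times> (complex ^ 'a). 1 - (cmod (snd p $ i))\<^sup>2"
  have r: "?r p \<noteq> 0" using gap_pos[OF assms, of i] by simp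
  let ?k = "c i * (snd v $ i \<bullet> snd w $ i)"
  have "((\<lambda>t. ?k / t\<^sup>2) has_real_derivative - 2 * ?k / t ^ 3) (at t)" if "t \<noteq> 0" for t
    using that by (auto intro!: derivative_eq_intros simp: power2_eq_square power3_eq_cube divide_simps)
  from DERIV_compose_FDERIV[OF this[OF r] gap_has_derivative]
  show "((\<lambda>p. ?k / (?r p)\<^sup>2) has_derivative
      (\<lambda>u. 4 * ?k * (snd p $ i \<bullet> snd u $ i) / ?r p ^ 3)) (at p)"
    by (rule has_derivative_eq_rhs) (simp add: fun_eq_iff)
qed

text \<open>
  The right-hand side is the bracket of the Koszul formula for a disc, up to the conformal factor:
  complex multiplication encodes the three inner product terms at once.
\<close>

lemma disc_koszul:
  fixes z v w u :: complex
  shows "(cnj z * (v * w)) \<bullet> u = (w \<bullet> u) * (z \<bullet> v) + (v \<bullet> u) * (z \<bullet> w) - (v \<bullet> w) * (z \<bullet> u)"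
  by (simp add: inner_complex_def algebra_simps)

text \<open>Existence is the Koszul identity in each factor; uniqueness is nondegeneracy of the metric.\<close>

lemma christoffel_disc:
  assumes "a > 0" "\<forall>i. c i > 0" "p \<in> refl_space"
  shows "christoffel (disc_metric a c) p v w = disc_Gamma p v w"
proof -
  let ?g = "disc_metric a c"
  let ?K = "\<lambda>z. (frechet_derivative (\<lambda>q. ?g q w z) (at p) v + frechet_derivative (\<lambda>q. ?g q v z) (at p) w
      - frechet_derivative (\<lambda>q. ?g q v w) (at p) z) / 2"
  have fd: "frechet_derivative (\<lambda>p. ?g p v w) (at p) =
    (\<lambda>u. - 2 * a * (fst v * fst w) * fst u / (fst p) ^ 3 +
       (\<Sum>i\<in>UNIV. 4 * (c i * (snd v $ i \<bullet> snd w $ i)) * (snd p $ i \<bullet> snd u $ i) /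
          (1 - (cmod (snd p $ i))\<^sup>2) ^ 3))" for v w
    using frechet_derivative_at[OF disc_metric_has_derivative[OF assms(3)]] by simp
  have K: "?g p (disc_Gamma p v w) z = ?K z" for z
  proof -
    have P: "fst p \<noteq> 0" using assms by (simp add: refl_space_iff)
    have r: "1 - (cmod (snd p $ i))\<^sup>2 \<noteq> 0" for i using gap_pos[OF assms(3), of i] by simp
    have "a * (- (fst v * fst w) / fst p * fst z) / (fst p)\<^sup>2 =
      (- 2 * a * (fst w * fst z) * fst v / (fst p) ^ 3 + - 2 * a * (fst v * fst z) * fst w / (fst p) ^ 3
        - - 2 * a * (fst v * fst w) * fst z / (fst p) ^ 3) / 2"
      using P by (simp add: field_simps power2_eq_square power3_eq_cube)
    moreover have "c i * ((2 / s) *\<^sub>R (cnj (snd p $ i) * (snd v $ i * snd w $ i)) \<bullet> snd z $ i) / s\<^sup>2 =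
      (4 * c i * (snd w $ i \<bullet> snd z $ i) * (snd p $ i \<bullet> snd v $ i) / s ^ 3
       + 4 * c i * (snd v $ i \<bullet> snd z $ i) * (snd p $ i \<bullet> snd w $ i) / s ^ 3
       - 4 * (c i * (snd v $ i \<bullet> snd w $ i)) * (snd p $ i \<bullet> snd z $ i) / s ^ 3) / 2"
      if "s \<noteq> 0" for i s
      using that unfolding inner_scaleR_left disc_koszul
      by (simp add: field_simps power2_eq_square power3_eq_cube)
    ultimately show ?thesis
      unfolding fd unfolding disc_metric_def disc_Gamma_def using r
      by (simp add: add_divide_distrib diff_divide_distrib sum.distrib sum_subtractf sum_divide_distrib)
  qed
  have uniq: "x = y" if "\<forall>z. ?g p x z = ?g p y z" for x y
  proof (rule ccontr)
    assume "x \<noteq> y"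
    then have "?g p (x - y) (x - y) > 0"
      using disc_metric_pos[OF assms] by simp
    moreover have "?g p (x - y) (x - y) = ?g p x (x - y) - ?g p y (x - y)"
      using bilinear_disc_metric bilinear_lsub by blast
    ultimately show False using that by simp
  qed
  show ?thesis
    unfolding christoffel_def
  proof (rule the_equality)
    show "\<forall>z. ?g p (disc_Gamma p v w) z = ?K z" using K by blast
    show "x = disc_Gamma p v w" if "\<forall>z. ?g p x z = ?K z" for x
      by (rule uniq) (simp only: K that, simp)
  qed
qed

lemma levi_civita_const_disc:
  assumes "a > 0" "\<forall>i. c i > 0" "p \<in> refl_space"
  shows "levi_civita (disc_metric a c) (\<lambda>_. v) (\<lambda>_. w) p = disc_Gamma p v w"
  by (simp add: levi_civita_def christoffel_disc[OF assms])

lemma levi_civita2_const_disc: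
  assumes "a > 0" "\<forall>i. c i > 0" "p \<in> refl_space"
  shows "levi_civita (disc_metric a c) (\<lambda>_. u) (levi_civita (disc_metric a c) (\<lambda>_. v) (\<lambda>_. w)) p =
    disc_Gamma_deriv p v w u + disc_Gamma p u (disc_Gamma p v w)"
proof -
  have "(levi_civita (disc_metric a c) (\<lambda>_. v) (\<lambda>_. w) has_derivative disc_Gamma_deriv p v w) (at p)"
    by (rule has_derivative_transform_within_open[OF disc_Gamma_has_derivative[OF assms(3)] open_refl_space assms(3)])
       (simp add: levi_civita_const_disc[OF assms(1,2)])
  then show ?thesis
    by (simp add: levi_civita_def[of _ "\<lambda>_. u"] frechet_derivative_at[symmetric] christoffel_disc[OF assms]
        levi_civita_const_disc[OF assms])
qed

lemma curvature_disc:
  assumes "a > 0" "\<forall>i. c i > 0" "p \<in> refl_space"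
  shows "curvature (disc_metric a c) (\<lambda>_. u) (\<lambda>_. v) (\<lambda>_. w) p =
    (disc_Gamma_deriv p v w u + disc_Gamma p u (disc_Gamma p v w)) -
    (disc_Gamma_deriv p u w v + disc_Gamma p v (disc_Gamma p u w))"
proof -
  have "lie_bracket (\<lambda>_. u) (\<lambda>_. v) = (\<lambda>_. 0)"
    by (simp add: fun_eq_iff lie_bracket_def)
  moreover have "disc_Gamma p 0 w = 0"
    by (simp add: disc_Gamma_def prod_eq_iff vec_eq_iff)
  ultimately show ?thesis
    by (simp add: curvature_def levi_civita2_const_disc[OF assms] levi_civita_const_disc[OF assms])
qed

text \<open>
  The component of \<open>R(u,v)v\<close> in a disc is \<open>2 v (cnj u v - cnj v u) / r\<^sup>2\<close>: the two contributions of
  the derivative of \<open>\<Gamma>\<close> carry the factors \<open>1 / r\<close> and \<open>|z|\<^sup>2 / r\<^sup>2 = (1 - r) / r\<^sup>2\<close>, which add up to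
  \<open>1 / r\<^sup>2\<close>.
\<close>

lemma disc_curvature:
  fixes z u v :: complex
  assumes "r = 1 - (cmod z)\<^sup>2" "r \<noteq> 0"
  shows "(((2 / r) *\<^sub>R (cnj u * (v * v)) + (4 * (z \<bullet> u) / r\<^sup>2) *\<^sub>R (cnj z * (v * v))) -
          ((2 / r) *\<^sub>R (cnj v * (u * v)) + (4 * (z \<bullet> v) / r\<^sup>2) *\<^sub>R (cnj z * (u * v)))) \<bullet> u
        = - 4 * (Im (cnj u * v))\<^sup>2 / r\<^sup>2"
proof -
  have 1: "(cnj u * (v * v) - cnj v * (u * v)) \<bullet> u = - 2 * (Im (cnj u * v))\<^sup>2"
    by (simp add: inner_complex_def algebra_simps power2_eq_square)
  have 2: "((z \<bullet> u) *\<^sub>R (cnj z * (v * v)) - (z \<bullet> v) *\<^sub>R (cnj z * (u * v))) \<bullet> u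
      = - (1 - r) * (Im (cnj u * v))\<^sup>2"
    unfolding assms(1) cmod_power2 by (simp add: inner_complex_def algebra_simps power2_eq_square)
  have "(((2 / r) *\<^sub>R (cnj u * (v * v)) + (4 * (z \<bullet> u) / r\<^sup>2) *\<^sub>R (cnj z * (v * v))) -
          ((2 / r) *\<^sub>R (cnj v * (u * v)) + (4 * (z \<bullet> v) / r\<^sup>2) *\<^sub>R (cnj z * (u * v)))) \<bullet> u
     = 2 / r * ((cnj u * (v * v) - cnj v * (u * v)) \<bullet> u) +
       4 / r\<^sup>2 * (((z \<bullet> u) *\<^sub>R (cnj z * (v * v)) - (z \<bullet> v) *\<^sub>R (cnj z * (u * v))) \<bullet> u)"
    by (simp add: inner_diff_left inner_add_left algebra_simps)
  also have "\<dots> = - 4 * (Im (cnj u * v))\<^sup>2 / r\<^sup>2"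
    unfolding 1 2 using assms(2) by (simp add: field_simps power2_eq_square)
  finally show ?thesis .
qed

lemma curvature_numerator:
  assumes "a > 0" "\<forall>i. c i > 0" "p \<in> refl_space"
  shows "disc_metric a c p (curvature (disc_metric a c) (\<lambda>_. u) (\<lambda>_. v) (\<lambda>_. v) p) u =
    - 4 * (\<Sum>i\<in>UNIV. c i * (Im (cnj (snd u $ i) * snd v $ i))\<^sup>2 / (1 - (cmod (snd p $ i))\<^sup>2) ^ 4)"
proof -
  let ?R = "curvature (disc_metric a c) (\<lambda>_. u) (\<lambda>_. v) (\<lambda>_. v) p"
  let ?r = "\<lambda>i. 1 - (cmod (snd p $ i))\<^sup>2"
  have "fst ?R = 0"
    by (simp add: curvature_disc[OF assms] disc_Gamma_def disc_Gamma_deriv_def)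
  moreover have "snd ?R $ i \<bullet> snd u $ i = - 4 * (Im (cnj (snd u $ i) * snd v $ i))\<^sup>2 / (?r i)\<^sup>2" for i
  proof -
    have "snd ?R $ i =
       ((2 / ?r i) *\<^sub>R (cnj (snd u $ i) * (snd v $ i * snd v $ i)) +
        (4 * (snd p $ i \<bullet> snd u $ i) / (?r i)\<^sup>2) *\<^sub>R (cnj (snd p $ i) * (snd v $ i * snd v $ i))) -
       ((2 / ?r i) *\<^sub>R (cnj (snd v $ i) * (snd u $ i * snd v $ i)) +
        (4 * (snd p $ i \<bullet> snd v $ i) / (?r i)\<^sup>2) *\<^sub>R (cnj (snd p $ i) * (snd u $ i * snd v $ i)))"
      by (simp add: curvature_disc[OF assms] disc_Gamma_def disc_Gamma_deriv_def mult_ac)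
    then show ?thesis
      using disc_curvature[OF refl, of "snd p $ i"] gap_pos[OF assms(3), of i] by simp
  qed
  ultimately show ?thesis
    by (simp add: disc_metric_def sum_distrib_left sum_divide_distrib power4_eq_xxxx power2_eq_square mult_ac)
qed

section \<open>Curvature bounds\<close>

text \<open>
  The difference of the two sides is \<open>A B' + A' B - 2 C C'\<close>, which is nonnegative by the
  arithmetic-geometric mean inequality and the two Cauchy-Schwarz hypotheses.
\<close>

lemma gram_add:
  fixes A B C A' B' C' :: real
  assumes "A \<ge> 0" "B \<ge> 0" "A' \<ge> 0" "B' \<ge> 0" "C\<^sup>2 \<le> A * B" "C'\<^sup>2 \<le> A' * B'"
  shows "(A * B - C\<^sup>2) + (A' * B' - C'\<^sup>2) \<le> (A + A') * (B + B') - (C + C')\<^sup>2"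
proof -
  have "(2 * (C * C'))\<^sup>2 \<le> 4 * ((A * B) * (A' * B'))"
    using mult_mono[OF assms(5,6)] assms(1,2) by (simp add: power_mult_distrib)
  also have "\<dots> \<le> (A * B' + A' * B)\<^sup>2"
    using zero_le_power2[of "A * B' - A' * B"] by (simp add: power2_eq_square algebra_simps)
  finally have "2 * (C * C') \<le> A * B' + A' * B"
    by (rule power2_le_imp_le) (use assms in simp)
  then show ?thesis
    by (simp add: power2_eq_square algebra_simps)
qed

lemma gram_sum:
  fixes A B C :: "'i \<Rightarrow> real"
  assumes "finite I" "\<And>i. i \<in> I \<Longrightarrow> A i \<ge> 0" "\<And>i. i \<in> I \<Longrightarrow> B i \<ge> 0"
    "\<And>i. i \<in> I \<Longrightarrow> (C i)\<^sup>2 \<le> A i * B i"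
  shows "(\<Sum>i\<in>I. A i * B i - (C i)\<^sup>2) \<le> sum A I * sum B I - (sum C I)\<^sup>2"
  using assms
proof (induction I)
  case (insert j I)
  then have IH: "(\<Sum>i\<in>I. A i * B i - (C i)\<^sup>2) \<le> sum A I * sum B I - (sum C I)\<^sup>2"
    by simp
  moreover have "0 \<le> (\<Sum>i\<in>I. A i * B i - (C i)\<^sup>2)"
    using insert.prems by (intro sum_nonneg) simp
  ultimately have "(sum C I)\<^sup>2 \<le> sum A I * sum B I"
    by linarith
  then have "(A j * B j - (C j)\<^sup>2) + (sum A I * sum B I - (sum C I)\<^sup>2) \<le>
     (A j + sum A I) * (B j + sum B I) - (C j + sum C I)\<^sup>2"
    using insert.prems by (intro gram_add) (auto intro: sum_nonneg)
  with IH insert.hyps show ?case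
    by simp
qed simp

lemma lagrange_complex: "(cmod u)\<^sup>2 * (cmod v)\<^sup>2 - (u \<bullet> v)\<^sup>2 = (Im (cnj u * v))\<^sup>2"
  unfolding cmod_power2 by (simp add: inner_complex_def power2_eq_square algebra_simps)

text \<open>
  Here \<open>c\<^sub>i \<ge> 1\<close> enters: the Gram determinant in the \<open>i\<close>-th disc carries the factor \<open>c\<^sub>i\<^sup>2\<close>, the
  curvature only \<open>c\<^sub>i\<close>. The line contributes a vanishing Gram determinant.
\<close>

lemma gram_disc_metric_ge:
  assumes "a > 0" "\<forall>i. c i \<ge> 1" "p \<in> refl_space"
  shows "(\<Sum>i\<in>UNIV. c i * (Im (cnj (snd u $ i) * snd v $ i))\<^sup>2 / (1 - (cmod (snd p $ i))\<^sup>2) ^ 4)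
    \<le> disc_metric a c p u u * disc_metric a c p v v - (disc_metric a c p u v)\<^sup>2"
proof -
  have c: "c i \<ge> 0" for i using assms(2) order.trans[of 0 1 "c i"] by simp
  define m where "m i = c i / (1 - (cmod (snd p $ i))\<^sup>2)\<^sup>2" for i
  have m: "m i \<ge> 0" for i
    using c by (simp add: m_def)
  define G where "G x y = (\<Sum>i\<in>UNIV. m i * (snd x $ i \<bullet> snd y $ i))" for x y :: "real \<times> (complex ^ 'a)"
  have G: "disc_metric a c p x y = a * (fst x * fst y) / (fst p)\<^sup>2 + G x y" for x y
    by (simp add: disc_metric_def G_def m_def)
  have CS: "(m i * (snd u $ i \<bullet> snd v $ i))\<^sup>2 \<le> m i * (snd u $ i \<bullet> snd u $ i) * (m i * (snd v $ i \<bullet> snd v $ i))" for i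
    using mult_left_mono[OF Cauchy_Schwarz_ineq[of "snd u $ i" "snd v $ i"], of "(m i)\<^sup>2"]
    by (simp add: power2_eq_square mult_ac)
  have "(\<Sum>i\<in>UNIV. c i * (Im (cnj (snd u $ i) * snd v $ i))\<^sup>2 / (1 - (cmod (snd p $ i))\<^sup>2) ^ 4)
     \<le> (\<Sum>i\<in>UNIV. m i * (snd u $ i \<bullet> snd u $ i) * (m i * (snd v $ i \<bullet> snd v $ i)) - (m i * (snd u $ i \<bullet> snd v $ i))\<^sup>2)"
  proof (rule sum_mono)
    fix i
    let ?r = "1 - (cmod (snd p $ i))\<^sup>2" and ?w = "Im (cnj (snd u $ i) * snd v $ i)"
    have "c i * ?w\<^sup>2 \<le> c i * (c i * ?w\<^sup>2)"
      using assms(2) c[of i] mult_right_mono[of 1 "c i" "?w\<^sup>2"] by (intro mult_left_mono) auto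
    then have "c i * ?w\<^sup>2 / ?r ^ 4 \<le> c i * (c i * ?w\<^sup>2) / ?r ^ 4"
      by (intro divide_right_mono) auto
    also have "\<dots> = (m i)\<^sup>2 * ?w\<^sup>2"
      by (simp add: m_def power_divide power2_eq_square[of "c i"] mult_ac flip: power_mult)
    also have "\<dots> = m i * (snd u $ i \<bullet> snd u $ i) * (m i * (snd v $ i \<bullet> snd v $ i)) - (m i * (snd u $ i \<bullet> snd v $ i))\<^sup>2"
      unfolding lagrange_complex[symmetric] by (simp add: dot_square_norm algebra_simps power2_eq_square)
    finally show "c i * ?w\<^sup>2 / ?r ^ 4 \<le> \<dots>" .
  qed
  also have *: "\<dots> \<le> G u u * G v v - (G u v)\<^sup>2"
    unfolding G_def using m CS by (intro gram_sum) auto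
  also have "\<dots> \<le> (a * (fst u * fst u) / (fst p)\<^sup>2 + G u u) * (a * (fst v * fst v) / (fst p)\<^sup>2 + G v v)
      - (a * (fst u * fst v) / (fst p)\<^sup>2 + G u v)\<^sup>2"
  proof -
    have "0 \<le> (\<Sum>i\<in>UNIV. m i * (snd u $ i \<bullet> snd u $ i) * (m i * (snd v $ i \<bullet> snd v $ i)) - (m i * (snd u $ i \<bullet> snd v $ i))\<^sup>2)"
      using CS by (intro sum_nonneg) simp
    then have CSG: "(G u v)\<^sup>2 \<le> G u u * G v v"
      using * by linarith
    have eq: "(a * (fst u * fst v) / (fst p)\<^sup>2)\<^sup>2 = a * (fst u * fst u) / (fst p)\<^sup>2 * (a * (fst v * fst v) / (fst p)\<^sup>2)"
      by (simp add: power2_eq_square mult_ac)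
    have "G x x \<ge> 0" for x
      unfolding G_def using m by (intro sum_nonneg) simp
    then show ?thesis
      using gram_add[of "a * (fst u * fst u) / (fst p)\<^sup>2" "a * (fst v * fst v) / (fst p)\<^sup>2" "G u u" "G v v"
          "a * (fst u * fst v) / (fst p)\<^sup>2" "G u v"] CSG assms(1) eq by simp
  qed
  finally show ?thesis
    by (simp add: G)
qed

text \<open>
  The bounds hold for all \<open>u\<close> and \<open>v\<close>: if the Gram determinant vanishes, the quotient is \<open>0\<close> by
  the convention for division by zero.
\<close>

lemma sectional_curvature_disc_bounds:
  assumes "a > 0" "\<forall>i. c i \<ge> 1" "p \<in> refl_space"
  shows "- 4 \<le> sectional_curvature (disc_metric a c) p u v" "sectional_curvature (disc_metric a c) p u v \<le> 0"
proof -
  let ?S = "\<Sum>i\<in>UNIV. c i * (Im (cnj (snd u $ i) * snd v $ i))\<^sup>2 / (1 - (cmod (snd p $ i))\<^sup>2) ^ 4"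
  let ?D = "disc_metric a c p u u * disc_metric a c p v v - (disc_metric a c p u v)\<^sup>2"
  have c: "\<forall>i. c i > 0" using assms(2) less_le_trans[of 0 1 "c _"] by auto
  have S: "0 \<le> ?S" using c by (intro sum_nonneg) (simp add: less_imp_le)
  have D: "?S \<le> ?D" using gram_disc_metric_ge[OF assms] .
  have K: "sectional_curvature (disc_metric a c) p u v = - 4 * ?S / ?D"
    unfolding sectional_curvature_def curvature_numerator[OF assms(1) c assms(3)] ..
  have "?S / ?D \<le> 1" "0 \<le> ?S / ?D"
    using S D by (auto intro: divide_le_eq_1[THEN iffD2] divide_nonneg_nonneg simp: divide_le_eq_1)
  then show "- 4 \<le> sectional_curvature (disc_metric a c) p u v" "sectional_curvature (disc_metric a c) p u v \<le> 0"
    unfolding K times_divide_eq_right[symmetric] by linarith+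
qed

section \<open>Completeness of the reflection coefficient space\<close>

text \<open>
  The functions \<open>ln P\<close> and \<open>- ln (1 - |\<mu>\<^sub>i|\<^sup>2)\<close> tend to infinity in absolute value at the boundary
  of the space, which therefore is at infinite distance.
\<close>

lemma complete_disc_metric:
  assumes "a \<ge> 1" "\<forall>i. c i \<ge> 1"
  shows "riemannian_complete (refl_space :: (real \<times> (complex ^ 'm::finite)) set) (disc_metric a c)"
proof -
  let ?U = "refl_space :: (real \<times> (complex ^ 'm)) set"
  let ?g = "disc_metric a c"
  let ?r = "\<lambda>i p :: real \<times> (complex ^ 'm). 1 - (cmod (snd p $ i))\<^sup>2"
  define F :: "(real \<times> (complex ^ 'm) \<Rightarrow> real) set" where
    "F = {\<lambda>p. ln (fst p)} \<union> {f. \<exists>i e. f = (\<lambda>p. snd p $ i \<bullet> e)} \<union> {f. \<exists>i. f = (\<lambda>p. - ln (?r i p))}"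
  have c: "\<forall>i. c i > 0" "\<forall>i. c i \<ge> 0"
    using assms(2) by (auto intro: less_le_trans[of 0 1] order.trans[of 0 1])
  have a: "a > 0" "a \<ge> 0" using assms(1) by auto
  have P: "\<bar>fst v / fst p\<bar> \<le> sqrt (?g p v v)" for p v
  proof (rule real_le_rsqrt)
    have "\<bar>fst v / fst p\<bar>\<^sup>2 \<le> a * (fst v / fst p)\<^sup>2"
      unfolding power2_abs using mult_right_mono[OF assms(1), of "(fst v / fst p)\<^sup>2"] by simp
    then show "\<bar>fst v / fst p\<bar>\<^sup>2 \<le> ?g p v v"
      using disc_metric_ge_fst[OF c(2), of a v p] by linarith
  qed
  have M: "cmod (snd v $ i) / ?r i p \<le> sqrt (?g p v v)" for p v i
  proof (rule real_le_rsqrt)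
    have "(cmod (snd v $ i) / ?r i p)\<^sup>2 \<le> c i * (cmod (snd v $ i) / ?r i p)\<^sup>2"
      using mult_right_mono[of 1 "c i" "(cmod (snd v $ i) / ?r i p)\<^sup>2"] assms(2) by simp
    then show "(cmod (snd v $ i) / ?r i p)\<^sup>2 \<le> ?g p v v"
      using disc_metric_ge_snd[OF a(2) c(2), of i v p] by linarith
  qed
  show ?thesis
  proof (rule complete_by_lipschitz_functions[where F = F])
    show "riemannian_metric_on ?U ?g"
      by (rule riemannian_disc_metric[OF a(1) c(1)])
    show "convex ?U"
      by (rule convex_refl_space)
  next
    fix f assume "f \<in> F"
    then consider "f = (\<lambda>p. ln (fst p))" | i e where "f = (\<lambda>p. snd p $ i \<bullet> e)"
      | i where "f = (\<lambda>p. - ln (?r i p))"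
      unfolding F_def by blast
    then show "\<exists>f' C. \<forall>p\<in>?U. (f has_derivative f' p) (at p) \<and>
        (\<forall>v. \<bar>f' p v\<bar> \<le> C * sqrt (?g p v v))"
    proof cases
      case 1
      have "(f has_derivative (\<lambda>v. fst v / fst p)) (at p)" if "p \<in> ?U" for p
        unfolding 1 using that
        by (auto intro!: derivative_eq_intros simp: refl_space_iff fun_eq_iff divide_inverse)
      then show ?thesis
        using P by (intro exI[of _ "\<lambda>p v. fst v / fst p"] exI[of _ 1]) auto
    next
      case 2
      have "bounded_linear f"
        unfolding 2 by (rule bounded_linear_compose[OF bounded_linear_inner_left bounded_linear_coord])
      then have "(f has_derivative f) (at p)" for p
        by (rule bounded_linear_imp_has_derivative)
      moreover have "\<bar>f v\<bar> \<le> norm e * sqrt (?g p v v)" if "p \<in> ?U" for p v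
      proof -
        have "cmod (snd v $ i) * ?r i p \<le> cmod (snd v $ i)"
          by (simp add: mult_left_le)
        then have "cmod (snd v $ i) \<le> cmod (snd v $ i) / ?r i p"
          using gap_pos[OF that, of i] by (simp add: pos_le_divide_eq)
        then have "cmod (snd v $ i) \<le> sqrt (?g p v v)"
          using M[of v i p] by linarith
        then have "norm (snd v $ i) * norm e \<le> norm e * sqrt (?g p v v)"
          by (metis mult.commute mult_left_mono norm_ge_zero)
        then show ?thesis
          unfolding 2 using Cauchy_Schwarz_ineq2[of "snd v $ i" e] by linarith
      qed
      ultimately show ?thesis
        by (intro exI[of _ "\<lambda>_. f"] exI[of _ "norm e"]) blast
    next
      case 3
      have "(f has_derivative (\<lambda>v. 2 * (snd p $ i \<bullet> snd v $ i) / ?r i p)) (at p)" if "p \<in> ?U" for p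
      proof -
        have "((\<lambda>t. - ln t) has_real_derivative - 1 / ?r i p) (at (?r i p))"
          using gap_pos[OF that, of i] by (auto intro!: derivative_eq_intros)
        from DERIV_compose_FDERIV[OF this gap_has_derivative] show ?thesis
          unfolding 3 by (rule has_derivative_eq_rhs) (simp add: fun_eq_iff)
      qed
      moreover have "\<bar>2 * (snd p $ i \<bullet> snd v $ i) / ?r i p\<bar> \<le> 2 * sqrt (?g p v v)" if "p \<in> ?U" for p v
      proof -
        have "cmod (snd p $ i) \<le> 1"
          using that by (simp add: refl_space_iff less_imp_le)
        then have "cmod (snd p $ i) * cmod (snd v $ i) \<le> cmod (snd v $ i)"
          by (intro mult_left_le_one_le) auto
        then have "\<bar>snd p $ i \<bullet> snd v $ i\<bar> \<le> cmod (snd v $ i)"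
          using Cauchy_Schwarz_ineq2[of "snd p $ i" "snd v $ i"] by linarith
        then have "\<bar>snd p $ i \<bullet> snd v $ i\<bar> / ?r i p \<le> cmod (snd v $ i) / ?r i p"
          using gap_pos[OF that, of i] by (intro divide_right_mono) auto
        then have "\<bar>snd p $ i \<bullet> snd v $ i\<bar> / ?r i p \<le> sqrt (?g p v v)"
          using M[of v i p] by linarith
        then show ?thesis
          using gap_pos[OF that, of i] by (simp add: abs_mult)
      qed
      ultimately show ?thesis
        by (intro exI[of _ "\<lambda>p v. 2 * (snd p $ i \<bullet> snd v $ i) / ?r i p"] exI[of _ 2]) blast
    qed
  next
    fix x :: "nat \<Rightarrow> real \<times> (complex ^ 'm)"
    assume x: "\<forall>n. x n \<in> ?U" and "\<forall>f\<in>F. Cauchy (\<lambda>n. f (x n))"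
    then have conv: "convergent (\<lambda>n. f (x n))" if "f \<in> F" for f
      using that by (simp add: Cauchy_convergent_iff)
    have "convergent (\<lambda>n. ln (fst (x n)))"
      by (rule conv) (simp add: F_def)
    then obtain \<alpha> where "(\<lambda>n. ln (fst (x n))) \<longlonglongrightarrow> \<alpha>"
      by (auto simp: convergent_def)
    then have "(\<lambda>n. exp (ln (fst (x n)))) \<longlonglongrightarrow> exp \<alpha>"
      by (rule tendsto_exp)
    moreover have "exp (ln (fst (x n))) = fst (x n)" for n
      using x by (simp add: refl_space_iff)
    ultimately have lim_fst: "(\<lambda>n. fst (x n)) \<longlonglongrightarrow> exp \<alpha>"
      by simp
    have "convergent (\<lambda>n. snd (x n) $ i \<bullet> e)" for i e
      by (rule conv) (auto simp: F_def)
    then obtain l where l: "\<And>i e. (\<lambda>n. snd (x n) $ i \<bullet> e) \<longlonglongrightarrow> l i e"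
      unfolding convergent_def by metis
    define m where "m = (\<chi> i. Complex (l i 1) (l i \<i>))"
    have lim: "(\<lambda>n. snd (x n) $ i) \<longlonglongrightarrow> m $ i" for i
      using l[of i 1] l[of i \<i>] by (simp add: tendsto_complex_iff m_def)
    then have lim_snd: "(\<lambda>n. snd (x n)) \<longlonglongrightarrow> m"
      by (rule vec_tendstoI)
    have "cmod (m $ i) < 1" for i
    proof -
      have "convergent (\<lambda>n. - ln (?r i (x n)))"
        by (rule conv) (auto simp: F_def)
      then obtain \<beta> where "(\<lambda>n. - ln (?r i (x n))) \<longlonglongrightarrow> \<beta>"
        by (auto simp: convergent_def)
      then have "(\<lambda>n. exp (- (- ln (?r i (x n))))) \<longlonglongrightarrow> exp (- \<beta>)"
        by (intro tendsto_exp tendsto_minus)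
      moreover have "exp (- (- ln (?r i (x n)))) = ?r i (x n)" for n
        using gap_pos[of "x n" i] x by simp
      ultimately have "(\<lambda>n. ?r i (x n)) \<longlonglongrightarrow> exp (- \<beta>)"
        by simp
      moreover have "(\<lambda>n. ?r i (x n)) \<longlonglongrightarrow> 1 - (cmod (m $ i))\<^sup>2"
        by (intro tendsto_intros lim)
      ultimately have "1 - (cmod (m $ i))\<^sup>2 = exp (- \<beta>)"
        using LIMSEQ_unique by blast
      then have "(cmod (m $ i))\<^sup>2 < 1\<^sup>2"
        using exp_gt_zero[of "- \<beta>"] by (simp only: power_one)
      then show ?thesis
        by (rule power2_less_imp_less) simp
    qed
    then have "(exp \<alpha>, m) \<in> ?U"
      by (simp add: refl_space_iff)
    moreover have "x \<longlonglongrightarrow> (exp \<alpha>, m)"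
      using tendsto_Pair[OF lim_fst lim_snd] by simp
    ultimately show "\<exists>l\<in>?U. x \<longlonglongrightarrow> l"
      by blast
  qed
qed

section \<open>The reflection coefficient space is a Cartan-Hadamard manifold\<close>

theorem mainTheorem18:
  fixes n :: nat and idx :: "'m::finite \<Rightarrow> nat"
  assumes "n \<ge> 2"
    and "bij_betw idx UNIV {1..n - 1}"
  shows "cartan_hadamard (refl_space :: (real \<times> (complex ^ 'm)) set) (refl_metric n idx) \<and>
         (\<forall>K \<in> sectional_curvatures (refl_space :: (real \<times> (complex ^ 'm)) set) (refl_metric n idx).
            -4 \<le> K \<and> K \<le> 0)"
proof -
  let ?U = "refl_space :: (real \<times> (complex ^ 'm)) set"
  define c where "c = (\<lambda>i. real n - real (idx i))"
  have g: "refl_metric n idx = disc_metric (real n) c"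
    by (simp add: refl_metric_eq c_def)
  have n: "real n \<ge> 1" "real n > 0"
    using assms(1) by auto
  have c: "\<forall>i. c i \<ge> 1"
  proof
    fix i
    have "idx i \<in> {1..n - 1}"
      using assms(2) by (auto simp: bij_betw_def)
    then have "idx i + 1 \<le> n"
      using assms(1) by auto
    then show "c i \<ge> 1"
      unfolding c_def by linarith
  qed
  then have c0: "\<forall>i. c i > 0"
    by (auto intro: less_le_trans[of 0 1])
  have "\<forall>K \<in> sectional_curvatures ?U (refl_metric n idx). -4 \<le> K \<and> K \<le> 0"
    using sectional_curvature_disc_bounds[OF n(2) c] by (auto simp: sectional_curvatures_def g)
  then show ?thesis
    unfolding cartan_hadamard_def g
    using riemannian_disc_metric[OF n(2) c0] complete_disc_metric[OF n(1) c]
      convex_imp_simply_connected[OF convex_refl_space] by blast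
qed

end
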